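(* Let $(M,F)$ be the Minkowskian product Finsler manifold of the Finsler manifolds $(M_1,F_1)$ and $(M_2,F_2)$ with respect to a product function $f$, and let $\check\Gamma^\alpha_{\beta;\gamma}$ be the coefficients of the Berwald connection associated to $F$. Then $$\check\Gamma^i_{j;l}=\overset{1}{\check\Gamma}{}^i_{j;l},\qquad \check\Gamma^{i'}_{j';l'}=\overset{2}{\check\Gamma}{}^{i'}_{j';l'},$$ $$\check\Gamma^i_{j';l}=\check\Gamma^i_{j;l'}=\check\Gamma^i_{j';l'}=\check\Gamma^{i'}_{j';l}=\check\Gamma^{i'}_{j;l'}=\check\Gamma^{i'}_{j;l}=0,$$ where $\overset{1}{\check\Gamma}{}^i_{j;l}$ and $\overset{2}{\check\Gamma}{}^{i'}_{j';l'}$ are the Berwald connection coefficients associated to $F_1$ and $F_2$ respectively.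
   Context: A Finsler metric on a manifold $N$ is a function $F:TN\to[0,\infty)$ such that: $G=F^2$ is smooth on $TN\setminus\{0\}$; $F>0$ off the zero section; $F(x,\lambda y)=|\lambda|F(x,y)$ for all $\lambda\in\mathbb{R}$; and the Hessian $(G_{\alpha\beta})=\left(\frac{\partial^2G}{\partial y^\alpha\partial y^\beta}\right)$ (no factor $\frac12$) is positive definite off the zero section. $(G^{\alpha\beta})$ denotes the inverse matrix of $(G_{\alpha\beta})$. A product function is a continuous $f:[0,\infty)\times[0,\infty)\to[0,\infty)$ with: (a) $f(s,t)=0$ iff $(s,t)=(0,0)$; (b) $f(\lambda s,\lambda t)=\lambda f(s,t)$ for $\lambda\ge 0$; (c) $f$ is smooth on $(0,\infty)^2$; (d) $\frac{\partial f}{\partial s}\ne0$ and $\frac{\partial f}{\partial t}\neq0$ on $(0,\infty)^2$; (e) $\frac{\partial f}{\partial s}\frac{\partial f}{\partial t}-2f\frac{\partial^2f}{\partial s\partial t}\ne0$ on $(0,\infty)^2$. Given Finsler manifolds $(M_1,F_1)$, $(M_2,F_2)$ of dimensions $m$, $n$, put $K=F_1^2$, $H=F_2^2$. The Minkowskian product Finsler manifold with respect to $f$ is $M=M_1\times M_2$ with $F=\sqrt{f(K,H)}$ on $TM\cong TM_1\oplus TM_2$; write $G=F^2=f(K,H)$. Since $f$ is smooth only on the open quadrant, all geometric objects of $F$ are considered at points $(x,y)\in TM$ whose $TM_1$- and $TM_2$-components are both nonzero (i.e. $K\ne0$, $H\ne0$); $(G_{\alpha\beta})$ is invertible there. Local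 coordinates: $x=(x^i,x^{i'})$ with $(x^i)$ on $M_1$ and $(x^{i'})$ on $M_2$, with induced fiber coordinates $y=(y^i,y^{i'})$; Greek indices run over $1,\dots,m+n$, unprimed Latin indices over $1,\dots,m$, primed Latin indices over $m+1,\dots,m+n$. The summation convention is used. For a Finsler metric (or for the product $F$) with $G=F^2$, set $\mathbb{G}^\alpha=\frac12G^{\alpha\beta}\left(\frac{\partial^2G}{\partial y^\beta\partial x^\gamma}y^\gamma-\frac{\partial G}{\partial x^\beta}\right)$, $\Gamma^\alpha_\beta=\frac{\partial\mathbb{G}^\alpha}{\partial y^\beta}$; the Berwald connection coefficients are $\check\Gamma^\alpha_{\beta;\gamma}=\frac{\partial\Gamma^\alpha_\gamma}{\partial y^\beta}$. Superscripts $1$, $2$ over a symbol denote the same object computed for $(M_1,F_1)$ (evaluated at $(x^i,y^i)$) and $(M_2,F_2)$ (evaluated at $(x^{i'},y^{i'})$). *)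

theory Defs
  imports "HOL-Analysis.Analysis"
begin

text \<open>Meant for open \<open>S\<close>: all iterated directional derivatives up to order \<open>k\<close> exist and are
  continuous on \<open>S\<close>.\<close>

primrec differentiable_upto ::
  "nat \<Rightarrow> 'a::euclidean_space set \<Rightarrow> ('a \<Rightarrow> 'b::real_normed_vector) \<Rightarrow> bool" where
  "differentiable_upto 0 S f \<longleftrightarrow> continuous_on S f"
| "differentiable_upto (Suc k) S f \<longleftrightarrow>
     (\<forall>x\<in>S. f differentiable (at x)) \<and>
     (\<forall>v. differentiable_upto k S (\<lambda>x. frechet_derivative f (at x) v))"

definition smooth_on :: "'a::euclidean_space set \<Rightarrow> ('a \<Rightarrow> 'b::real_normed_vector) \<Rightarrow> bool" where
  "smooth_on S f \<longleftrightarrow> (\<forall>k. differentiable_upto k S f)"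

definition partial_deriv :: "'k::finite \<Rightarrow> (real^'k \<Rightarrow> real) \<Rightarrow> real^'k \<Rightarrow> real" where
  "partial_deriv \<alpha> g z = deriv (\<lambda>t. g (z + t *\<^sub>R axis \<alpha> 1)) 0"

text \<open>For a function \<open>G x y\<close> of base coordinates \<open>x\<close> and fibre coordinates \<open>y\<close>:
  \<open>\<partial>G/\<partial>x\<^sup>\<alpha>\<close> and \<open>\<partial>G/\<partial>y\<^sup>\<alpha>\<close>.\<close>

definition partial_x ::
  "'k::finite \<Rightarrow> (real^'k \<Rightarrow> real^'k \<Rightarrow> real) \<Rightarrow> real^'k \<Rightarrow> real^'k \<Rightarrow> real" where
  "partial_x \<alpha> G x y = partial_deriv \<alpha> (\<lambda>x'. G x' y) x"

definition partial_y ::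
  "'k::finite \<Rightarrow> (real^'k \<Rightarrow> real^'k \<Rightarrow> real) \<Rightarrow> real^'k \<Rightarrow> real^'k \<Rightarrow> real" where
  "partial_y \<alpha> G x y = partial_deriv \<alpha> (G x) y"

text \<open>A chart is a pair \<open>(U, \<phi>)\<close>; the values of \<open>\<phi>\<close> outside \<open>U\<close> are irrelevant.  Dimensions are
  given by finite index types.\<close>

type_synonym ('a, 'k) chart = "'a set \<times> ('a \<Rightarrow> real^'k)"

definition chart_image :: "('a, 'k::finite) chart \<Rightarrow> (real^'k) set" where
  "chart_image c = snd c ` fst c"

definition chart_inv :: "('a, 'k::finite) chart \<Rightarrow> real^'k \<Rightarrow> 'a" where
  "chart_inv c = inv_into (fst c) (snd c)"

definition smooth_manifold :: "'a topology \<Rightarrow> ('a, 'k::finite) chart set \<Rightarrow> bool" where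
  "smooth_manifold X A \<longleftrightarrow>
     Hausdorff_space X \<and> second_countable X \<and>
     (\<Union>c\<in>A. fst c) = topspace X \<and>
     (\<forall>c\<in>A. openin X (fst c) \<and> open (chart_image c) \<and>
        homeomorphic_map (subtopology X (fst c)) (top_of_set (chart_image c)) (snd c)) \<and>
     (\<forall>c\<in>A. \<forall>d\<in>A. smooth_on (snd c ` (fst c \<inter> fst d)) (snd d \<circ> chart_inv c))"

text \<open>Tangent vectors act on real functions.  \<open>coord_vector c p y\<close> is the vector
  \<open>y\<^sup>\<alpha> \<partial>/\<partial>x\<^sup>\<alpha>\<close> at \<open>p\<close>, where \<open>x\<^sup>\<alpha>\<close> are the coordinates of \<open>c\<close>.  It acts on the functions that
  are differentiable at \<open>p\<close>; all other functions are sent to \<open>0\<close>, so that equality of tangent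
  vectors is equality of functions.\<close>

type_synonym 'a tangent_vector = "('a \<Rightarrow> real) \<Rightarrow> real"

definition coord_vector :: "('a, 'k::finite) chart \<Rightarrow> 'a \<Rightarrow> real^'k \<Rightarrow> 'a tangent_vector" where
  "coord_vector c p y = (\<lambda>g. if (g \<circ> chart_inv c) differentiable (at (snd c p))
                             then frechet_derivative (g \<circ> chart_inv c) (at (snd c p)) y else 0)"

definition tangent_space :: "('a, 'k::finite) chart set \<Rightarrow> 'a \<Rightarrow> 'a tangent_vector set" where
  "tangent_space A p = {coord_vector c p y | c y. c \<in> A \<and> p \<in> fst c}"

text \<open>The differential of \<open>h\<close> applied to a tangent vector.\<close>

definition pushforward :: "('a \<Rightarrow> 'b) \<Rightarrow> 'a tangent_vector \<Rightarrow> 'b tangent_vector" where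
  "pushforward h v = (\<lambda>g. v (g \<circ> h))"

text \<open>A function on the tangent bundle takes a point and a tangent vector at this point.
  \<open>energy F c\<close> is \<open>G = F\<^sup>2\<close> in the coordinates \<open>(x, y)\<close> induced by \<open>c\<close> on the tangent bundle.\<close>

definition energy ::
  "('a \<Rightarrow> 'a tangent_vector \<Rightarrow> real) \<Rightarrow> ('a, 'k::finite) chart \<Rightarrow> real^'k \<Rightarrow> real^'k \<Rightarrow> real" where
  "energy F c x y = (F (chart_inv c x) (coord_vector c (chart_inv c x) y))\<^sup>2"

definition fibre_hessian ::
  "(real^'k \<Rightarrow> real^'k \<Rightarrow> real) \<Rightarrow> real^'k \<Rightarrow> real^'k \<Rightarrow> real^'k^('k::finite)" where
  "fibre_hessian G x y = (\<chi> \<alpha> \<beta>. partial_y \<alpha> (partial_y \<beta> G) x y)"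

definition finsler_manifold ::
  "'a topology \<Rightarrow> ('a, 'k::finite) chart set \<Rightarrow> ('a \<Rightarrow> 'a tangent_vector \<Rightarrow> real) \<Rightarrow> bool" where
  "finsler_manifold X A F \<longleftrightarrow>
     smooth_manifold X A \<and>
     (\<forall>p\<in>topspace X. \<forall>v\<in>tangent_space A p.
        F p v \<ge> 0 \<and> (v \<noteq> (\<lambda>_. 0) \<longrightarrow> F p v > 0) \<and>
        (\<forall>r. F p (\<lambda>g. r * v g) = \<bar>r\<bar> * F p v)) \<and>
     (\<forall>c\<in>A. smooth_on (chart_image c \<times> (UNIV - {0})) (\<lambda>(x, y). energy F c x y)) \<and>
     (\<forall>c\<in>A. \<forall>x\<in>chart_image c. \<forall>y. y \<noteq> 0 \<longrightarrow>
        (\<forall>w. w \<noteq> 0 \<longrightarrow> w \<bullet> (fibre_hessian (energy F c) x y *v w) > 0))"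

definition spray_coeff ::
  "(real^'k \<Rightarrow> real^'k \<Rightarrow> real) \<Rightarrow> 'k::finite \<Rightarrow> real^'k \<Rightarrow> real^'k \<Rightarrow> real" where
  "spray_coeff G \<alpha> x y = 1/2 * (\<Sum>\<beta>\<in>UNIV. matrix_inv (fibre_hessian G x y) $ \<alpha> $ \<beta> *
     ((\<Sum>\<gamma>\<in>UNIV. partial_y \<beta> (partial_x \<gamma> G) x y * y $ \<gamma>) - partial_x \<beta> G x y))"

definition nonlinear_coeff ::
  "(real^'k \<Rightarrow> real^'k \<Rightarrow> real) \<Rightarrow> 'k::finite \<Rightarrow> 'k \<Rightarrow> real^'k \<Rightarrow> real^'k \<Rightarrow> real" where
  "nonlinear_coeff G \<alpha> \<beta> = partial_y \<beta> (spray_coeff G \<alpha>)"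

text \<open>\<open>berwald_coeff F c x y \<alpha> \<beta> \<gamma>\<close> has the upper index \<open>\<alpha>\<close> and the lower indices \<open>\<beta>;\<gamma>\<close>.\<close>

definition berwald_coeff ::
  "('a \<Rightarrow> 'a tangent_vector \<Rightarrow> real) \<Rightarrow> ('a, 'k::finite) chart \<Rightarrow> real^'k \<Rightarrow> real^'k \<Rightarrow>
     'k \<Rightarrow> 'k \<Rightarrow> 'k \<Rightarrow> real" where
  "berwald_coeff F c x y \<alpha> \<beta> \<gamma> = partial_y \<beta> (nonlinear_coeff (energy F c) \<alpha> \<gamma>) x y"

definition product_function :: "(real \<Rightarrow> real \<Rightarrow> real) \<Rightarrow> bool" where
  "product_function f \<longleftrightarrow>
     continuous_on ({0..} \<times> {0..}) (\<lambda>(s, t). f s t) \<and>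
     (\<forall>s\<ge>0. \<forall>t\<ge>0. f s t \<ge> 0 \<and> (f s t = 0 \<longleftrightarrow> s = 0 \<and> t = 0)) \<and>
     (\<forall>r\<ge>0. \<forall>s\<ge>0. \<forall>t\<ge>0. f (r * s) (r * t) = r * f s t) \<and>
     smooth_on ({0<..} \<times> {0<..}) (\<lambda>(s, t). f s t) \<and>
     (\<forall>s>0. \<forall>t>0. deriv (\<lambda>s'. f s' t) s \<noteq> 0 \<and> deriv (\<lambda>t'. f s t') t \<noteq> 0 \<and>
        deriv (\<lambda>s'. f s' t) s * deriv (\<lambda>t'. f s t') t
          - 2 * f s t * deriv (\<lambda>s'. deriv (\<lambda>t'. f s' t') t) s \<noteq> 0)"

text \<open>Coordinates on the product: unprimed indices are \<open>Inl i\<close>, primed indices are \<open>Inr i'\<close>.\<close>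

definition join_vec :: "real^'m \<Rightarrow> real^'n \<Rightarrow> real^('m::finite + 'n::finite)" where
  "join_vec u v = (\<chi> \<alpha>. case \<alpha> of Inl i \<Rightarrow> u $ i | Inr i' \<Rightarrow> v $ i')"

definition product_chart ::
  "('a, 'm::finite) chart \<Rightarrow> ('b, 'n::finite) chart \<Rightarrow> ('a \<times> 'b, 'm + 'n) chart" where
  "product_chart c d = (fst c \<times> fst d, \<lambda>(p, q). join_vec (snd c p) (snd d q))"

text \<open>A tangent vector of the product is identified with the pair of its images under the
  differentials of the two projections.\<close>

definition minkowskian_product ::
  "(real \<Rightarrow> real \<Rightarrow> real) \<Rightarrow> ('a \<Rightarrow> 'a tangent_vector \<Rightarrow> real) \<Rightarrow> ('b \<Rightarrow> 'b tangent_vector \<Rightarrow> real) \<Rightarrow>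
     'a \<times> 'b \<Rightarrow> ('a \<times> 'b) tangent_vector \<Rightarrow> real" where
  "minkowskian_product f F1 F2 = (\<lambda>(p, q) v.
     sqrt (f ((F1 p (pushforward fst v))\<^sup>2) ((F2 q (pushforward snd v))\<^sup>2)))"

end

theory Submission
  imports Defs
begin

text \<open>
  In product coordinates the energy is \<open>G = f(K, H)\<close>.  The proof shows that the spray of \<open>G\<close> is
  the pair of the sprays of \<open>K\<close> and \<open>H\<close>, at every point where both fibre components are nonzero
  (\<open>spray_coeff_product\<close>).  These points form an open set, on which the unprimed spray coefficients
  then depend on the first factor only and the primed ones on the second only; differentiating
  twice in the fibre gives all the identities at once.

  Twice the spray of \<open>G\<close> is the solution \<open>w\<close> of \<open>A w = R\<close>, where \<open>A\<close> is the fibre Hessian of \<open>G\<close> and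
  \<open>R\<^sub>\<beta> = G\<^sub>\<beta>\<^sub>;\<^sub>\<gamma> y\<^sup>\<gamma> - G\<^sub>;\<^sub>\<beta>\<close>, subscripts after the semicolon being base derivatives.  By
  the chain rule, with \<open>\<langle>_,_\<rangle>\<close> the pairing of a gradient and a vector and \<open>A\<^sub>K\<close>, \<open>R\<^sub>K\<close> the data of
  \<open>K\<close>, the unprimed components are

    \<open>A (u, v) = f\<^sub>s A\<^sub>K u + (f\<^sub>s\<^sub>s \<langle>\<partial>\<^sub>y K, u\<rangle> + f\<^sub>s\<^sub>t \<langle>\<partial>\<^sub>y H, v\<rangle>) \<partial>\<^sub>y K\<close>,

    \<open>R = f\<^sub>s R\<^sub>K + (f\<^sub>s\<^sub>s \<langle>\<partial>\<^sub>x K, y\<^sub>1\<rangle> + f\<^sub>s\<^sub>t \<langle>\<partial>\<^sub>x H, y\<^sub>2\<rangle>) \<partial>\<^sub>y K\<close>,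

  and the primed ones are alike.  If \<open>g\<close> is twice the spray of \<open>K\<close>, then \<open>A\<^sub>K g = R\<^sub>K\<close> by definition
  and \<open>\<langle>\<partial>\<^sub>y K, g\<rangle> = \<langle>\<partial>\<^sub>x K, y\<^sub>1\<rangle>\<close> by homogeneity, which says that \<open>K\<close> is constant along its
  geodesics (\<open>grad_y_spray_dir\<close>).  The same holds for twice the spray \<open>h\<close> of \<open>H\<close>, so \<open>(g, h)\<close>
  solves the system.

  The solution is unique because \<open>A\<close> has trivial kernel (\<open>fibre_hessian_product_kernel\<close>).  Since
  \<open>A\<^sub>K y\<^sub>1 = \<partial>\<^sub>y K\<close>, a kernel vector has the form \<open>(\<lambda> y\<^sub>1, \<mu> y\<^sub>2)\<close>.  On such vectors \<open>A\<close> acts as a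
  two by two matrix, whose determinant Euler's relations for \<open>f\<close> turn into
  \<open>f\<^sub>s f\<^sub>t - 2 f f\<^sub>s\<^sub>t\<close>; this is nonzero by condition (e) on product functions.

  What remains is the passage to coordinates: the differentials of the two projections send the
  coordinate vector \<open>(u, v)\<close> of a product chart to the coordinate vectors \<open>u\<close> and \<open>v\<close> of its factors
  (\<open>pushforward_coord_vector\<close>), so the energy of the product is indeed \<open>f(K, H)\<close>
  (\<open>energy_minkowskian_product\<close>).
\<close>

section \<open>Directional derivatives and Euler's relation\<close>

text \<open>Coordinate derivatives are derivatives of a function of one real variable, whereas smoothness is
  stated with Frechet derivatives.  This lemma connects the two, for arbitrary directions, so that
  it also serves for functions on a product of vector spaces.\<close>

lemma DERIV_along_line:
  fixes g :: "'a::real_normed_vector \<Rightarrow> real"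
  assumes "g differentiable (at z)"
  shows "((\<lambda>t. g (z + t *\<^sub>R v)) has_real_derivative frechet_derivative g (at z) v) (at 0)"
proof -
  have g: "(g has_derivative frechet_derivative g (at z)) (at (z + 0 *\<^sub>R v))"
    using frechet_derivative_works[THEN iffD1, OF assms] by simp
  have line: "((\<lambda>t. z + t *\<^sub>R v) has_derivative (\<lambda>t. t *\<^sub>R v)) (at (0::real))"
    by (auto intro!: derivative_eq_intros)
  have "((\<lambda>t. g (z + t *\<^sub>R v)) has_derivative (\<lambda>t. frechet_derivative g (at z) (t *\<^sub>R v))) (at 0)"
    using has_derivative_compose[OF line g] by simp
  moreover have "frechet_derivative g (at z) (t *\<^sub>R v) = frechet_derivative g (at z) v * t" for t
    using linear_frechet_derivative[OF assms] by (simp add: linear_cmul)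
  ultimately show ?thesis by (simp add: has_field_derivative_def)
qed

lemma partial_deriv_eq_frechet:
  assumes "g differentiable (at z)"
  shows "partial_deriv \<alpha> g z = frechet_derivative g (at z) (axis \<alpha> 1)"
  unfolding partial_deriv_def by (rule DERIV_imp_deriv[OF DERIV_along_line[OF assms]])

lemma DERIV_partial_deriv:
  assumes "g differentiable (at z)"
  shows "((\<lambda>t. g (z + t *\<^sub>R axis \<alpha> 1)) has_real_derivative partial_deriv \<alpha> g z) (at 0)"
  using DERIV_along_line[OF assms] partial_deriv_eq_frechet[OF assms] by simp

lemma frechet_eq_sum_partial_deriv:
  assumes "g differentiable (at z)"
  shows "frechet_derivative g (at z) w = (\<Sum>j\<in>UNIV. w $ j * partial_deriv j g z)"
proof -
  have lin: "linear (frechet_derivative g (at z))"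
    by (rule linear_frechet_derivative[OF assms])
  have "frechet_derivative g (at z) w
      = frechet_derivative g (at z) (\<Sum>j\<in>UNIV. w $ j *\<^sub>R axis j 1)"
    using basis_expansion[of w] by (simp add: scalar_mult_eq_scaleR)
  also have "\<dots> = (\<Sum>j\<in>UNIV. w $ j *\<^sub>R frechet_derivative g (at z) (axis j 1))"
    by (simp add: linear_sum[OF lin] linear_cmul[OF lin])
  finally show ?thesis by (simp add: partial_deriv_eq_frechet[OF assms])
qed

lemma deriv_cong_on_line:
  fixes z v :: "'a::real_normed_vector"
  assumes "open S" "z \<in> S" "\<And>w. w \<in> S \<Longrightarrow> g w = h w"
  shows "deriv (\<lambda>t. g (z + t *\<^sub>R v)) (0::real) = deriv (\<lambda>t. h (z + t *\<^sub>R v)) 0"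
proof (rule deriv_cong_ev)
  have "open ((\<lambda>t. z + t *\<^sub>R v) -` S)"
    by (intro open_vimage assms continuous_intros)
  then show "\<forall>\<^sub>F t in nhds 0. g (z + t *\<^sub>R v) = h (z + t *\<^sub>R v)"
    using assms(2,3) by (auto simp: eventually_nhds)
qed simp

lemma partial_deriv_cong:
  assumes "open S" "z \<in> S" "\<And>w. w \<in> S \<Longrightarrow> g w = h w"
  shows "partial_deriv \<alpha> g z = partial_deriv \<alpha> h z"
  unfolding partial_deriv_def by (rule deriv_cong_on_line[OF assms])

lemma partial_deriv_const [simp]: "partial_deriv \<alpha> (\<lambda>_. c) z = 0"
  by (simp add: partial_deriv_def)

text \<open>The function is a multiple of \<open>(1 + t)\<^sup>k\<close> along the ray through \<open>z\<close>.\<close>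

lemma euler_homogeneous:
  fixes g :: "'a::real_normed_vector \<Rightarrow> real"
  assumes g: "g differentiable (at z)" and hom: "\<And>r. r > 0 \<Longrightarrow> g (r *\<^sub>R z) = r ^ k * g z"
  shows "frechet_derivative g (at z) z = real k * g z"
proof -
  have eq: "g (z + t *\<^sub>R z) = (1 + t) ^ k * g z" if "t > -1" for t
    using hom[of "1 + t"] that by (simp add: scaleR_add_left)
  have "((\<lambda>t. (1 + t) ^ k * g z) has_real_derivative real k * g z) (at 0)"
    by (auto intro!: derivative_eq_intros)
  then have "((\<lambda>t. g (z + t *\<^sub>R z)) has_real_derivative real k * g z) (at 0)"
    by (rule has_field_derivative_transform_within_open[where S = "{-1<..}"]) (auto simp: eq)
  then show ?thesis using DERIV_along_line[OF g] DERIV_unique by blast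
qed

lemma euler_homogeneous_partial:
  assumes "g differentiable (at y)" "\<And>r. r > 0 \<Longrightarrow> g (r *\<^sub>R y) = r ^ k * g y"
  shows "(\<Sum>j\<in>UNIV. y $ j * partial_deriv j g y) = real k * g y"
  using euler_homogeneous[OF assms] frechet_eq_sum_partial_deriv[OF assms(1)] by simp

text \<open>The equations that define the spray contain derivatives of the energy up to order two: the
  energy is differentiated, and its first derivatives are differentiated once more.\<close>

lemma smooth_on_differentiable:
  assumes "smooth_on S g" "z \<in> S"
  shows "g differentiable (at z)"
    and "(\<lambda>w. frechet_derivative g (at w) v) differentiable (at z)"
proof -
  have "differentiable_upto (Suc (Suc 0)) S g" using assms unfolding smooth_on_def by blast
  then show "g differentiable (at z)"
    and "(\<lambda>w. frechet_derivative g (at w) v) differentiable (at z)"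
    using assms(2) by simp_all
qed

lemma differentiable_cong_open:
  assumes "g differentiable (at z)" "open S" "z \<in> S" "\<And>w. w \<in> S \<Longrightarrow> g w = h w"
  shows "h differentiable (at z)"
  using assms has_derivative_transform_within_open unfolding differentiable_def by blast

section \<open>Homogeneous functions of two variables\<close>

definition dfst :: "(real \<Rightarrow> real \<Rightarrow> real) \<Rightarrow> real \<Rightarrow> real \<Rightarrow> real" where
  "dfst f s t = deriv (\<lambda>s'. f s' t) s"

definition dsnd :: "(real \<Rightarrow> real \<Rightarrow> real) \<Rightarrow> real \<Rightarrow> real \<Rightarrow> real" where
  "dsnd f s t = deriv (\<lambda>t'. f s t') t"

lemma dfst_eq_frechet:
  assumes "(\<lambda>(s, t). f s t) differentiable (at (s, t))"
  shows "((\<lambda>s'. f s' t) has_real_derivative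
            frechet_derivative (\<lambda>(s, t). f s t) (at (s, t)) (1, 0)) (at s)"
    and "dfst f s t = frechet_derivative (\<lambda>(s, t). f s t) (at (s, t)) (1, 0)"
proof -
  show D: "((\<lambda>s'. f s' t) has_real_derivative
            frechet_derivative (\<lambda>(s, t). f s t) (at (s, t)) (1, 0)) (at s)"
    using DERIV_along_line[OF assms, of "(1, 0)"] DERIV_shift[of "\<lambda>s'. f s' t" _ 0 s]
    by (simp add: add.commute)
  show "dfst f s t = frechet_derivative (\<lambda>(s, t). f s t) (at (s, t)) (1, 0)"
    unfolding dfst_def by (rule DERIV_imp_deriv[OF D])
qed

lemma dsnd_eq_frechet:
  assumes "(\<lambda>(s, t). f s t) differentiable (at (s, t))"
  shows "((\<lambda>t'. f s t') has_real_derivative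
            frechet_derivative (\<lambda>(s, t). f s t) (at (s, t)) (0, 1)) (at t)"
    and "dsnd f s t = frechet_derivative (\<lambda>(s, t). f s t) (at (s, t)) (0, 1)"
proof -
  show D: "((\<lambda>t'. f s t') has_real_derivative
            frechet_derivative (\<lambda>(s, t). f s t) (at (s, t)) (0, 1)) (at t)"
    using DERIV_along_line[OF assms, of "(0, 1)"] DERIV_shift[of "\<lambda>t'. f s t'" _ 0 t]
    by (simp add: add.commute)
  show "dsnd f s t = frechet_derivative (\<lambda>(s, t). f s t) (at (s, t)) (0, 1)"
    unfolding dsnd_def by (rule DERIV_imp_deriv[OF D])
qed

lemma DERIV_dfst:
  assumes "(\<lambda>(s, t). f s t) differentiable (at (s, t))"
  shows "((\<lambda>s'. f s' t) has_real_derivative dfst f s t) (at s)"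
  using dfst_eq_frechet[OF assms] by simp

lemma DERIV_dsnd:
  assumes "(\<lambda>(s, t). f s t) differentiable (at (s, t))"
  shows "((\<lambda>t'. f s t') has_real_derivative dsnd f s t) (at t)"
  using dsnd_eq_frechet[OF assms] by simp

lemma euler_homogeneous_pair:
  assumes f: "(\<lambda>(s, t). f s t) differentiable (at (s, t))"
    and hom: "\<And>r. r > 0 \<Longrightarrow> f (r * s) (r * t) = r ^ k * f s t"
  shows "s * dfst f s t + t * dsnd f s t = real k * f s t"
proof -
  let ?D = "frechet_derivative (\<lambda>(s, t). f s t) (at (s, t))"
  have lin: "linear ?D" by (rule linear_frechet_derivative[OF f])
  have "?D (s, t) = ?D (s *\<^sub>R (1, 0) + t *\<^sub>R (0, 1))" by simp
  also have "\<dots> = s * ?D (1, 0) + t * ?D (0, 1)"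
    unfolding linear_add[OF lin] linear_cmul[OF lin] by simp
  finally show ?thesis
    using euler_homogeneous[OF f, of k] hom
    by (simp add: dfst_eq_frechet(2)[OF f] dsnd_eq_frechet(2)[OF f])
qed

context
  fixes f :: "real \<Rightarrow> real \<Rightarrow> real"
  assumes pf: "product_function f"
begin

lemma product_function_smooth: "smooth_on ({0<..} \<times> {0<..}) (\<lambda>(s, t). f s t)"
  using pf by (simp add: product_function_def)

lemma product_function_homogeneous: "r > 0 \<Longrightarrow> s > 0 \<Longrightarrow> t > 0 \<Longrightarrow> f (r * s) (r * t) = r * f s t"
  using pf by (simp add: product_function_def)

lemma product_function_differentiable:
  assumes "s > 0" "t > 0"
  shows "(\<lambda>(s, t). f s t) differentiable (at (s, t))"
  using smooth_on_differentiable(1)[OF product_function_smooth] assms by simp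

lemma dfst_differentiable:
  assumes "s > 0" "t > 0"
  shows "(\<lambda>(s, t). dfst f s t) differentiable (at (s, t))"
proof (rule differentiable_cong_open)
  show "(\<lambda>w. frechet_derivative (\<lambda>(s, t). f s t) (at w) (1, 0)) differentiable at (s, t)"
    using smooth_on_differentiable(2)[OF product_function_smooth] assms by simp
  show "open ({0<..} \<times> {0<..} :: (real \<times> real) set)" by (intro open_Times open_greaterThan)
qed (use assms in \<open>auto simp: dfst_eq_frechet(2)[OF product_function_differentiable]\<close>)

lemma dsnd_differentiable:
  assumes "s > 0" "t > 0"
  shows "(\<lambda>(s, t). dsnd f s t) differentiable (at (s, t))"
proof (rule differentiable_cong_open)
  show "(\<lambda>w. frechet_derivative (\<lambda>(s, t). f s t) (at w) (0, 1)) differentiable at (s, t)"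
    using smooth_on_differentiable(2)[OF product_function_smooth] assms by simp
  show "open ({0<..} \<times> {0<..} :: (real \<times> real) set)" by (intro open_Times open_greaterThan)
qed (use assms in \<open>auto simp: dsnd_eq_frechet(2)[OF product_function_differentiable]\<close>)

lemma dfst_homogeneous:
  assumes "r > 0" "s > 0" "t > 0"
  shows "dfst f (r * s) (r * t) = dfst f s t"
proof -
  have "((\<lambda>s'. f (r * s') (r * t)) has_real_derivative dfst f (r * s) (r * t) * r) (at s)"
    by (rule DERIV_chain2[OF DERIV_dfst[OF product_function_differentiable]])
       (use assms in \<open>auto intro!: derivative_eq_intros\<close>)
  then have "((\<lambda>s'. r * f s' t) has_real_derivative dfst f (r * s) (r * t) * r) (at s)"
    by (rule has_field_derivative_transform_within_open[where S = "{0<..}"])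
       (use assms in \<open>auto simp: product_function_homogeneous\<close>)
  moreover have "((\<lambda>s'. r * f s' t) has_real_derivative r * dfst f s t) (at s)"
    by (intro DERIV_cmult DERIV_dfst product_function_differentiable assms)
  ultimately show ?thesis using DERIV_unique assms by fastforce
qed

lemma dsnd_homogeneous:
  assumes "r > 0" "s > 0" "t > 0"
  shows "dsnd f (r * s) (r * t) = dsnd f s t"
proof -
  have "((\<lambda>t'. f (r * s) (r * t')) has_real_derivative dsnd f (r * s) (r * t) * r) (at t)"
    by (rule DERIV_chain2[OF DERIV_dsnd[OF product_function_differentiable]])
       (use assms in \<open>auto intro!: derivative_eq_intros\<close>)
  then have "((\<lambda>t'. r * f s t') has_real_derivative dsnd f (r * s) (r * t) * r) (at t)"
    by (rule has_field_derivative_transform_within_open[where S = "{0<..}"])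
       (use assms in \<open>auto simp: product_function_homogeneous\<close>)
  moreover have "((\<lambda>t'. r * f s t') has_real_derivative r * dsnd f s t) (at t)"
    by (intro DERIV_cmult DERIV_dsnd product_function_differentiable assms)
  ultimately show ?thesis using DERIV_unique assms by fastforce
qed

lemma product_function_euler:
  assumes "s > 0" "t > 0"
  shows "s * dfst f s t + t * dsnd f s t = f s t"
    and "s * dfst (dfst f) s t + t * dsnd (dfst f) s t = 0"
    and "s * dfst (dsnd f) s t + t * dsnd (dsnd f) s t = 0"
  using euler_homogeneous_pair[OF product_function_differentiable[OF assms], of 1]
    euler_homogeneous_pair[OF dfst_differentiable[OF assms], of 0]
    euler_homogeneous_pair[OF dsnd_differentiable[OF assms], of 0]
  by (simp_all add: assms product_function_homogeneous dfst_homogeneous dsnd_homogeneous)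

text \<open>The symmetry comes from homogeneity: differentiating Euler's relation
  \<open>f = s f\<^sub>s + t f\<^sub>t\<close> in \<open>s\<close>, and writing Euler's relation for \<open>f\<^sub>s\<close>, which is homogeneous of degree
  zero, give the same expression \<open>- s f\<^sub>s\<^sub>s\<close> for \<open>t\<close> times either mixed derivative.\<close>

lemma product_function_mixed_partials:
  assumes "s > 0" "t > 0"
  shows "dsnd (dfst f) s t = dfst (dsnd f) s t"
proof -
  have "((\<lambda>s'. s' * dfst f s' t + t * dsnd f s' t) has_real_derivative
      dfst f s t + s * dfst (dfst f) s t + t * dfst (dsnd f) s t) (at s)"
    by (auto intro!: derivative_eq_intros DERIV_dfst dfst_differentiable dsnd_differentiable assms)
  then have "((\<lambda>s'. f s' t) has_real_derivative
      dfst f s t + s * dfst (dfst f) s t + t * dfst (dsnd f) s t) (at s)"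
    by (rule has_field_derivative_transform_within_open[where S = "{0<..}"])
       (use assms in \<open>auto simp: product_function_euler(1)\<close>)
  then have "s * dfst (dfst f) s t + t * dfst (dsnd f) s t = 0"
    using DERIV_unique[OF _ DERIV_dfst[OF product_function_differentiable[OF assms]]] by fastforce
  then have "t * dsnd (dfst f) s t = t * dfst (dsnd f) s t"
    using product_function_euler(2)[OF assms] by linarith
  then show ?thesis using assms by simp
qed

lemma product_function_nondegenerate:
  assumes "s > 0" "t > 0"
  shows "dfst f s t \<noteq> 0" and "dsnd f s t \<noteq> 0"
    and "dfst f s t * dsnd f s t - 2 * f s t * dfst (dsnd f) s t \<noteq> 0"
  using pf assms by (simp_all add: product_function_def dfst_def dsnd_def)

end

section \<open>Finsler energies in a chart\<close>

text \<open>The properties of the coordinate expression \<open>K = F\<^sup>2\<close> of a Finsler metric from which its spray is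
  computed.  Strict positivity is derived from them in \<open>energy_pos\<close>.\<close>

definition finsler_energy ::
  "(real^'k) set \<Rightarrow> (real^'k \<Rightarrow> real^'k \<Rightarrow> real) \<Rightarrow> bool" where
  "finsler_energy U K \<longleftrightarrow> open U \<and>
     smooth_on (U \<times> (UNIV - {0})) (\<lambda>(x, y). K x y) \<and>
     (\<forall>x\<in>U. \<forall>r y. K x (r *\<^sub>R y) = r\<^sup>2 * K x y) \<and>
     (\<forall>x\<in>U. \<forall>y. y \<noteq> 0 \<longrightarrow> (\<forall>w. w \<noteq> 0 \<longrightarrow> w \<bullet> (fibre_hessian K x y *v w) > 0))"

definition grad_y :: "(real^'k \<Rightarrow> real^'k \<Rightarrow> real) \<Rightarrow> real^'k \<Rightarrow> real^'k \<Rightarrow> real^('k::finite)" where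
  "grad_y G x y = (\<chi> \<alpha>. partial_y \<alpha> G x y)"

definition grad_x :: "(real^'k \<Rightarrow> real^'k \<Rightarrow> real) \<Rightarrow> real^'k \<Rightarrow> real^'k \<Rightarrow> real^('k::finite)" where
  "grad_x G x y = (\<chi> \<alpha>. partial_x \<alpha> G x y)"

text \<open>The covector to which the inverse of the fibre Hessian is applied in the definition of the
  spray.\<close>

definition spray_rhs :: "(real^'k \<Rightarrow> real^'k \<Rightarrow> real) \<Rightarrow> real^'k \<Rightarrow> real^'k \<Rightarrow> real^('k::finite)" where
  "spray_rhs G x y =
     (\<chi> \<beta>. (\<Sum>\<gamma>\<in>UNIV. partial_y \<beta> (partial_x \<gamma> G) x y * y $ \<gamma>) - partial_x \<beta> G x y)"

text \<open>Twice the spray.  Without the factor \<open>1/2\<close> it is the solution \<open>w\<close> of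
  \<open>fibre_hessian G x y *v w = spray_rhs G x y\<close>.\<close>

definition spray_dir :: "(real^'k \<Rightarrow> real^'k \<Rightarrow> real) \<Rightarrow> real^'k \<Rightarrow> real^'k \<Rightarrow> real^('k::finite)" where
  "spray_dir G x y = matrix_inv (fibre_hessian G x y) *v spray_rhs G x y"

lemma spray_coeff_eq: "spray_coeff G \<alpha> x y = 1/2 * spray_dir G x y $ \<alpha>"
  by (simp add: spray_coeff_def spray_dir_def spray_rhs_def matrix_vector_mult_def)

lemma invertible_of_trivial_kernel:
  fixes A :: "real^'k^'k"
  assumes "\<And>w. A *v w = 0 \<Longrightarrow> w = 0"
  shows "invertible A"
  using assms by (simp add: invertible_left_inverse matrix_left_invertible_ker)

lemma matrix_inv_inverse:
  fixes A :: "real^'k^'k"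
  assumes "invertible A"
  shows "A ** matrix_inv A = mat 1" and "matrix_inv A ** A = mat 1"
  using someI_ex[OF assms[unfolded invertible_def]] by (simp_all add: matrix_inv_def)

lemma matrix_inv_mult_vector_unique:
  fixes A :: "real^'k^'k"
  assumes "invertible A" "A *v w = b"
  shows "matrix_inv A *v b = w"
  using matrix_inv_inverse(2)[OF assms(1)] assms(2) by (auto simp: matrix_vector_mul_assoc)

context
  fixes U :: "(real^'k::finite) set" and K
  assumes fe: "finsler_energy U K"
begin

lemma finsler_energy_open: "open U"
  using fe by (simp add: finsler_energy_def)

lemma finsler_energy_homogeneous: "x \<in> U \<Longrightarrow> K x (r *\<^sub>R y) = r\<^sup>2 * K x y"
  using fe by (simp add: finsler_energy_def)

lemma finsler_energy_uncurried:
  assumes "x \<in> U" "y \<noteq> 0"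
  shows "(\<lambda>(x, y). K x y) differentiable (at (x, y))"
    and "(\<lambda>w. frechet_derivative (\<lambda>(x, y). K x y) (at w) v) differentiable (at (x, y))"
  using smooth_on_differentiable[of "U \<times> (UNIV - {0})" "\<lambda>(x, y). K x y" "(x, y)"] fe assms
  by (simp_all add: finsler_energy_def)

lemma partial_y_eq_frechet:
  assumes "x \<in> U" "y \<noteq> 0"
  shows "partial_y j K x y = frechet_derivative (\<lambda>(x, y). K x y) (at (x, y)) (0, axis j 1)"
  using DERIV_imp_deriv[OF DERIV_along_line[OF finsler_energy_uncurried(1)[OF assms], of "(0, axis j 1)"]]
  by (simp add: partial_y_def partial_deriv_def)

lemma partial_x_eq_frechet:
  assumes "x \<in> U" "y \<noteq> 0"
  shows "partial_x j K x y = frechet_derivative (\<lambda>(x, y). K x y) (at (x, y)) (axis j 1, 0)"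
  using DERIV_imp_deriv[OF DERIV_along_line[OF finsler_energy_uncurried(1)[OF assms], of "(axis j 1, 0)"]]
  by (simp add: partial_x_def partial_deriv_def)

lemma finsler_energy_differentiable:
  assumes "x \<in> U" "y \<noteq> 0"
  shows "K x differentiable (at y)" and "(\<lambda>x. K x y) differentiable (at x)"
proof -
  have "(\<lambda>(x, y). K x y) \<circ> Pair x differentiable (at y)"
    by (intro differentiable_chain_at finsler_energy_uncurried(1) assms differentiable_Pair) auto
  then show "K x differentiable (at y)" by (simp add: o_def)
  have "(\<lambda>(x, y). K x y) \<circ> (\<lambda>x. (x, y)) differentiable (at x)"
    by (intro differentiable_chain_at finsler_energy_uncurried(1) assms differentiable_Pair) auto
  then show "(\<lambda>x. K x y) differentiable (at x)" by (simp add: o_def)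
qed

lemma frechet_differentiable_in_fibre:
  assumes "x \<in> U" "y \<noteq> 0"
  shows "(\<lambda>y. frechet_derivative (\<lambda>(x, y). K x y) (at (x, y)) v) differentiable (at y)"
proof -
  have "(\<lambda>w. frechet_derivative (\<lambda>(x, y). K x y) (at w) v) \<circ> Pair x differentiable (at y)"
    by (intro differentiable_chain_at finsler_energy_uncurried(2) assms differentiable_Pair) auto
  then show ?thesis by (simp add: o_def)
qed

lemma partial_y_differentiable:
  assumes "x \<in> U" "y \<noteq> 0"
  shows "partial_y j K x differentiable (at y)"
  by (rule differentiable_cong_open[OF frechet_differentiable_in_fibre[OF assms], of "-{0}" "(0, axis j 1)"])
     (use assms in \<open>auto simp: partial_y_eq_frechet\<close>)

lemma partial_x_differentiable:
  assumes "x \<in> U" "y \<noteq> 0"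
  shows "partial_x j K x differentiable (at y)"
  by (rule differentiable_cong_open[OF frechet_differentiable_in_fibre[OF assms], of "-{0}" "(axis j 1, 0)"])
     (use assms in \<open>auto simp: partial_x_eq_frechet\<close>)

lemma DERIV_fibre:
  assumes "x \<in> U" "y \<noteq> 0"
  shows "((\<lambda>t. K x (y + t *\<^sub>R axis i 1)) has_real_derivative partial_y i K x y) (at 0)"
    and "((\<lambda>t. partial_y j K x (y + t *\<^sub>R axis i 1)) has_real_derivative
            partial_y i (partial_y j K) x y) (at 0)"
    and "((\<lambda>t. partial_x j K x (y + t *\<^sub>R axis i 1)) has_real_derivative
            partial_y i (partial_x j K) x y) (at 0)"
  unfolding partial_y_def[of i]
  by (intro DERIV_partial_deriv finsler_energy_differentiable partial_y_differentiable
        partial_x_differentiable assms)+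

lemma DERIV_base:
  assumes "x \<in> U" "y \<noteq> 0"
  shows "((\<lambda>t. K (x + t *\<^sub>R axis i 1) y) has_real_derivative partial_x i K x y) (at 0)"
  unfolding partial_x_def using finsler_energy_differentiable(2)[OF assms]
  by (rule DERIV_partial_deriv)

lemma partial_y_homogeneous:
  assumes "x \<in> U" "y \<noteq> 0" "r > 0"
  shows "partial_y j K x (r *\<^sub>R y) = r * partial_y j K x y"
proof -
  have "((\<lambda>t. K x (r *\<^sub>R y + t *\<^sub>R axis j 1)) has_real_derivative partial_y j K x (r *\<^sub>R y)) (at (r * 0))"
    using DERIV_fibre(1)[of x "r *\<^sub>R y"] assms by simp
  then have "((\<lambda>t. K x (r *\<^sub>R y + (r * t) *\<^sub>R axis j 1)) has_real_derivative
      partial_y j K x (r *\<^sub>R y) * r) (at 0)"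
    by (rule DERIV_chain2) (auto intro!: derivative_eq_intros)
  moreover have "K x (r *\<^sub>R y + (r * t) *\<^sub>R axis j 1) = r\<^sup>2 * K x (y + t *\<^sub>R axis j 1)" for t
    using finsler_energy_homogeneous[OF assms(1), of r "y + t *\<^sub>R axis j 1"]
    by (simp add: scaleR_add_right)
  moreover have "((\<lambda>t. r\<^sup>2 * K x (y + t *\<^sub>R axis j 1)) has_real_derivative r\<^sup>2 * partial_y j K x y) (at 0)"
    by (intro DERIV_cmult DERIV_fibre assms)
  ultimately have "partial_y j K x (r *\<^sub>R y) * r = r\<^sup>2 * partial_y j K x y"
    using DERIV_unique by fastforce
  then show ?thesis using assms(3) by (simp add: power2_eq_square)
qed

lemma partial_x_homogeneous:
  assumes "x \<in> U" "y \<noteq> 0"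
  shows "partial_x j K x (r *\<^sub>R y) = r\<^sup>2 * partial_x j K x y"
proof -
  have "partial_x j K x (r *\<^sub>R y) = partial_deriv j (\<lambda>x. r\<^sup>2 * K x y) x"
    unfolding partial_x_def
    by (rule partial_deriv_cong[OF finsler_energy_open assms(1)])
       (rule finsler_energy_homogeneous)
  also have "\<dots> = r\<^sup>2 * partial_x j K x y"
    unfolding partial_deriv_def
    by (intro DERIV_imp_deriv DERIV_cmult DERIV_base assms)
  finally show ?thesis .
qed

lemma energy_euler:
  assumes "x \<in> U" "y \<noteq> 0"
  shows "grad_y K x y \<bullet> y = 2 * K x y"
  using euler_homogeneous_partial[OF finsler_energy_differentiable(1)[OF assms], of 2]
  by (simp add: finsler_energy_homogeneous[OF assms(1)] grad_y_def inner_vec_def partial_y_def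
      mult.commute)

lemma partial_y_euler:
  assumes "x \<in> U" "y \<noteq> 0"
  shows "(\<Sum>i\<in>UNIV. y $ i * partial_y i (partial_y j K) x y) = partial_y j K x y"
  using euler_homogeneous_partial[where k = 1, OF partial_y_differentiable[OF assms, of j]]
  by (simp add: partial_y_homogeneous[OF assms] partial_y_def[of _ "partial_y j K"])

lemma partial_x_euler:
  assumes "x \<in> U" "y \<noteq> 0"
  shows "(\<Sum>i\<in>UNIV. y $ i * partial_y i (partial_x j K) x y) = 2 * partial_x j K x y"
  using euler_homogeneous_partial[where k = 2, OF partial_x_differentiable[OF assms, of j]]
  by (simp add: partial_x_homogeneous[OF assms] partial_y_def[of _ "partial_x j K"])

text \<open>The derivatives \<open>K\<^sub>j\<close> are homogeneous of degree one in the fibre, so contracting the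
  derivative index, the row index of \<open>fibre_hessian\<close>, with \<open>y\<close> is Euler's relation for them.\<close>

lemma inner_fibre_hessian:
  assumes "x \<in> U" "y \<noteq> 0"
  shows "y \<bullet> (fibre_hessian K x y *v w) = grad_y K x y \<bullet> w"
proof -
  have "y v* fibre_hessian K x y = grad_y K x y"
    using partial_y_euler[OF assms]
    by (simp add: vec_eq_iff vector_matrix_mult_def fibre_hessian_def grad_y_def mult.commute)
  then show ?thesis by (metis dot_lmul_matrix)
qed

text \<open>The column index of \<open>fibre_hessian\<close> belongs to the inner derivative, and here it is the one
  contracted with \<open>y\<close>.  Differentiating Euler's relation \<open>y\<^sup>j K\<^sub>j = 2 K\<close> in \<open>y\<^sup>i\<close> gives
  \<open>K\<^sub>i + y\<^sup>j \<partial>\<^sub>i K\<^sub>j = 2 K\<^sub>i\<close>.\<close>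

lemma fibre_hessian_mult_self:
  assumes "x \<in> U" "y \<noteq> 0"
  shows "fibre_hessian K x y *v y = grad_y K x y"
proof -
  have "(\<Sum>j\<in>UNIV. partial_y i (partial_y j K) x y * y $ j) = partial_y i K x y" for i
  proof -
    have eq: "(\<Sum>j\<in>UNIV. u $ j * partial_y j K x u) = 2 * K x u" if "u \<in> - {0}" for u
      using energy_euler[of x u] assms that
      by (simp add: grad_y_def inner_vec_def mult.commute)
    have "((\<lambda>t. (\<Sum>j\<in>UNIV. (y + t *\<^sub>R axis i 1) $ j * partial_y j K x (y + t *\<^sub>R axis i 1)))
        has_real_derivative
        (\<Sum>j\<in>UNIV. axis i 1 $ j * partial_y j K x y + partial_y i (partial_y j K) x y * y $ j)) (at 0)"
    proof (rule DERIV_sum)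
      fix j
      have "((\<lambda>t. (y + t *\<^sub>R axis i 1) $ j) has_real_derivative axis i 1 $ j) (at 0)"
        by (auto intro!: derivative_eq_intros)
      from DERIV_mult[OF this DERIV_fibre(2)[OF assms]]
      show "((\<lambda>t. (y + t *\<^sub>R axis i 1) $ j * partial_y j K x (y + t *\<^sub>R axis i 1)) has_real_derivative
        axis i 1 $ j * partial_y j K x y + partial_y i (partial_y j K) x y * y $ j) (at 0)"
        by simp
    qed
    then have "partial_deriv i (\<lambda>u. \<Sum>j\<in>UNIV. u $ j * partial_y j K x u) y
        = partial_y i K x y + (\<Sum>j\<in>UNIV. partial_y i (partial_y j K) x y * y $ j)"
      unfolding partial_deriv_def
      by (subst DERIV_imp_deriv) (auto simp: sum.distrib axis_def if_distrib[of "\<lambda>a. a * _"] cong: if_cong)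
    moreover have "partial_deriv i (\<lambda>u. \<Sum>j\<in>UNIV. u $ j * partial_y j K x u) y
        = partial_deriv i (\<lambda>u. 2 * K x u) y"
      by (rule partial_deriv_cong[of "- {0}"]) (use assms eq in auto)
    moreover have "partial_deriv i (\<lambda>u. 2 * K x u) y = 2 * partial_y i K x y"
      unfolding partial_deriv_def by (intro DERIV_imp_deriv DERIV_cmult DERIV_fibre assms)
    ultimately show ?thesis by simp
  qed
  then show ?thesis by (simp add: vec_eq_iff matrix_vector_mult_def fibre_hessian_def grad_y_def)
qed

lemma fibre_hessian_pos:
  assumes "x \<in> U" "y \<noteq> 0" "w \<noteq> 0"
  shows "w \<bullet> (fibre_hessian K x y *v w) > 0"
  using fe assms by (simp add: finsler_energy_def)

text \<open>By the Euler relations, \<open>2 K\<close> is the value of the Hessian form at \<open>y\<close>.\<close>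

lemma energy_pos:
  assumes "x \<in> U" "y \<noteq> 0"
  shows "K x y > 0"
  using fibre_hessian_pos[OF assms assms(2)] inner_fibre_hessian[OF assms, of y] energy_euler[OF assms]
  by simp

lemma fibre_hessian_kernel:
  assumes "x \<in> U" "y \<noteq> 0" "fibre_hessian K x y *v w = 0"
  shows "w = 0"
  using fibre_hessian_pos[OF assms(1,2), of w] assms(3) by auto

lemma fibre_hessian_spray_dir:
  assumes "x \<in> U" "y \<noteq> 0"
  shows "fibre_hessian K x y *v spray_dir K x y = spray_rhs K x y"
proof -
  have "invertible (fibre_hessian K x y)"
    by (rule invertible_of_trivial_kernel) (rule fibre_hessian_kernel[OF assms])
  then show ?thesis
    by (simp add: spray_dir_def matrix_vector_mul_assoc matrix_inv_inverse)
qed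

text \<open>Contract \<open>A\<^sub>K g = R\<^sub>K\<close> with \<open>y\<close>.  On the left, \<open>y\<close> contracted with the Hessian is the fibre
  gradient.  On the right, the base derivatives of \<open>K\<close> are homogeneous of degree two in the fibre, so
  the first term is twice \<open>\<langle>\<partial>\<^sub>x K, y\<rangle>\<close> and the second removes one copy.  Geometrically, the energy is
  constant along geodesics.\<close>

lemma grad_y_spray_dir:
  assumes "x \<in> U" "y \<noteq> 0"
  shows "grad_y K x y \<bullet> spray_dir K x y = grad_x K x y \<bullet> y"
proof -
  have "y \<bullet> spray_rhs K x y
      = (\<Sum>\<beta>\<in>UNIV. \<Sum>\<gamma>\<in>UNIV. y $ \<beta> * (partial_y \<beta> (partial_x \<gamma> K) x y * y $ \<gamma>))
        - grad_x K x y \<bullet> y"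
    by (simp add: inner_vec_def spray_rhs_def grad_x_def right_diff_distrib sum_subtractf
        sum_distrib_left mult.commute)
  also have "(\<Sum>\<beta>\<in>UNIV. \<Sum>\<gamma>\<in>UNIV. y $ \<beta> * (partial_y \<beta> (partial_x \<gamma> K) x y * y $ \<gamma>))
      = (\<Sum>\<gamma>\<in>UNIV. (\<Sum>\<beta>\<in>UNIV. y $ \<beta> * partial_y \<beta> (partial_x \<gamma> K) x y) * y $ \<gamma>)"
    by (subst sum.swap) (simp add: sum_distrib_right mult.assoc)
  also have "\<dots> = 2 * (grad_x K x y \<bullet> y)"
    by (simp add: partial_x_euler[OF assms] inner_vec_def grad_x_def sum_distrib_left mult.assoc)
  finally have "y \<bullet> spray_rhs K x y = grad_x K x y \<bullet> y" by simp
  then show ?thesis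
    using inner_fibre_hessian[OF assms] fibre_hessian_spray_dir[OF assms] by metis
qed

end

section \<open>The spray of a product energy\<close>

lemma join_vec_nth [simp]: "join_vec u v $ Inl i = u $ i" "join_vec u v $ Inr j = v $ j"
  by (simp_all add: join_vec_def)

lemma sum_UNIV_Plus:
  fixes g :: "'m::finite + 'n::finite \<Rightarrow> real"
  shows "(\<Sum>\<alpha>\<in>UNIV. g \<alpha>) = (\<Sum>i\<in>UNIV. g (Inl i)) + (\<Sum>j\<in>UNIV. g (Inr j))"
  using sum.Plus[of "UNIV :: 'm set" "UNIV :: 'n set" g] by (simp add: o_def)

lemma vec_sum_eq_iff:
  fixes w z :: "real^('m::finite + 'n::finite)"
  shows "w = z \<longleftrightarrow> (\<forall>i. w $ Inl i = z $ Inl i) \<and> (\<forall>j. w $ Inr j = z $ Inr j)"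
  by (metis sum.exhaust_sel vec_eq_iff)

lemma join_vec_cases:
  fixes w :: "real^('m::finite + 'n::finite)"
  obtains u v where "w = join_vec u v"
  by (rule that[of "\<chi> i. w $ Inl i" "\<chi> j. w $ Inr j"]) (simp add: vec_sum_eq_iff)

lemma join_vec_move:
  fixes u :: "real^'m::finite" and v :: "real^'n::finite"
  shows "join_vec u v + t *\<^sub>R axis (Inl i) 1 = join_vec (u + t *\<^sub>R axis i 1) v"
    and "join_vec u v + t *\<^sub>R axis (Inr j) 1 = join_vec u (v + t *\<^sub>R axis j 1)"
  by (simp_all add: vec_sum_eq_iff axis_def)

lemma partial_y_Inl_eq:
  "partial_y (Inl i) Q X (join_vec y1 y2) = partial_deriv i (\<lambda>u. Q X (join_vec u y2)) y1"
  by (simp add: partial_y_def partial_deriv_def join_vec_move)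

lemma partial_y_Inr_eq:
  "partial_y (Inr j) Q X (join_vec y1 y2) = partial_deriv j (\<lambda>u. Q X (join_vec y1 u)) y2"
  by (simp add: partial_y_def partial_deriv_def join_vec_move)

context
  fixes U :: "(real^'m::finite) set" and K
    and V :: "(real^'n::finite) set" and H
    and f :: "real \<Rightarrow> real \<Rightarrow> real" and G :: "real^('m + 'n) \<Rightarrow> real^('m + 'n) \<Rightarrow> real"
  assumes feK: "finsler_energy U K" and feH: "finsler_energy V H"
    and pf: "product_function f"
    and G: "\<And>x1 x2 y1 y2. x1 \<in> U \<Longrightarrow> x2 \<in> V \<Longrightarrow>
              G (join_vec x1 x2) (join_vec y1 y2) = f (K x1 y1) (H x2 y2)"
begin

text \<open>The fibre derivatives of \<open>f(K, H)\<close> and of its first partial derivatives are all fibre derivatives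
  of a function of the form \<open>\<phi>(K, H) a\<close>, where \<open>\<phi>\<close> is \<open>f\<close> or one of its first derivatives and \<open>a\<close> is
  \<open>1\<close> or a first derivative of \<open>K\<close> or \<open>H\<close>.  This lemma and the next treat the two kinds of direction.\<close>

lemma partial_y_Inl_product:
  assumes P: "x1 \<in> U" "y1 \<noteq> 0"
    and Q: "\<And>u. u \<noteq> 0 \<Longrightarrow> Q (join_vec x1 x2) (join_vec u y2) = \<phi> (K x1 u) h * a u"
    and \<phi>: "(\<lambda>(s, t). \<phi> s t) differentiable (at (K x1 y1, h))"
    and a: "((\<lambda>t. a (y1 + t *\<^sub>R axis i 1)) has_real_derivative a') (at 0)"
  shows "partial_y (Inl i) Q (join_vec x1 x2) (join_vec y1 y2)
           = dfst \<phi> (K x1 y1) h * partial_y i K x1 y1 * a y1 + \<phi> (K x1 y1) h * a'"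
proof -
  have "partial_y (Inl i) Q (join_vec x1 x2) (join_vec y1 y2)
      = partial_deriv i (\<lambda>u. Q (join_vec x1 x2) (join_vec u y2)) y1"
    by (rule partial_y_Inl_eq)
  also have "\<dots> = partial_deriv i (\<lambda>u. \<phi> (K x1 u) h * a u) y1"
    by (rule partial_deriv_cong[of "- {0}"]) (use P Q in auto)
  also have "\<dots> = dfst \<phi> (K x1 y1) h * partial_y i K x1 y1 * a y1 + \<phi> (K x1 y1) h * a'"
  proof -
    have "((\<lambda>s. \<phi> s h) has_real_derivative dfst \<phi> (K x1 y1) h) (at (K x1 (y1 + 0 *\<^sub>R axis i 1)))"
      using DERIV_dfst[OF \<phi>] by simp
    from DERIV_mult[OF DERIV_chain2[OF this DERIV_fibre(1)[OF feK P]] a]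
    show ?thesis unfolding partial_deriv_def by (intro DERIV_imp_deriv) (simp add: mult.commute add.commute)
  qed
  finally show ?thesis .
qed

lemma partial_y_Inr_product:
  assumes P: "x2 \<in> V" "y2 \<noteq> 0"
    and Q: "\<And>u. u \<noteq> 0 \<Longrightarrow> Q (join_vec x1 x2) (join_vec y1 u) = \<phi> k (H x2 u) * a u"
    and \<phi>: "(\<lambda>(s, t). \<phi> s t) differentiable (at (k, H x2 y2))"
    and a: "((\<lambda>t. a (y2 + t *\<^sub>R axis i 1)) has_real_derivative a') (at 0)"
  shows "partial_y (Inr i) Q (join_vec x1 x2) (join_vec y1 y2)
           = dsnd \<phi> k (H x2 y2) * partial_y i H x2 y2 * a y2 + \<phi> k (H x2 y2) * a'"
proof -
  have "partial_y (Inr i) Q (join_vec x1 x2) (join_vec y1 y2)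
      = partial_deriv i (\<lambda>u. Q (join_vec x1 x2) (join_vec y1 u)) y2"
    by (rule partial_y_Inr_eq)
  also have "\<dots> = partial_deriv i (\<lambda>u. \<phi> k (H x2 u) * a u) y2"
    by (rule partial_deriv_cong[of "- {0}"]) (use P Q in auto)
  also have "\<dots> = dsnd \<phi> k (H x2 y2) * partial_y i H x2 y2 * a y2 + \<phi> k (H x2 y2) * a'"
  proof -
    have "((\<lambda>s. \<phi> k s) has_real_derivative dsnd \<phi> k (H x2 y2)) (at (H x2 (y2 + 0 *\<^sub>R axis i 1)))"
      using DERIV_dsnd[OF \<phi>] by simp
    from DERIV_mult[OF DERIV_chain2[OF this DERIV_fibre(1)[OF feH P]] a]
    show ?thesis unfolding partial_deriv_def by (intro DERIV_imp_deriv) (simp add: mult.commute add.commute)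
  qed
  finally show ?thesis .
qed

context
  fixes x1 :: "real^'m" and x2 :: "real^'n"
  assumes x1: "x1 \<in> U" and x2: "x2 \<in> V"
begin

lemma first_partials_product:
  assumes "y1 \<noteq> 0" "y2 \<noteq> 0"
  shows "partial_y (Inl i) G (join_vec x1 x2) (join_vec y1 y2)
           = dfst f (K x1 y1) (H x2 y2) * partial_y i K x1 y1"
    and "partial_y (Inr j) G (join_vec x1 x2) (join_vec y1 y2)
           = dsnd f (K x1 y1) (H x2 y2) * partial_y j H x2 y2"
    and "partial_x (Inl i) G (join_vec x1 x2) (join_vec y1 y2)
           = dfst f (K x1 y1) (H x2 y2) * partial_x i K x1 y1"
    and "partial_x (Inr j) G (join_vec x1 x2) (join_vec y1 y2)
           = dsnd f (K x1 y1) (H x2 y2) * partial_x j H x2 y2"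
proof -
  have f: "(\<lambda>(s, t). f s t) differentiable (at (K x1 y1, H x2 y2))"
    by (intro product_function_differentiable pf energy_pos[OF feK] energy_pos[OF feH] x1 x2 assms)
  show "partial_y (Inl i) G (join_vec x1 x2) (join_vec y1 y2)
           = dfst f (K x1 y1) (H x2 y2) * partial_y i K x1 y1"
    by (subst partial_y_Inl_product[where a = "\<lambda>_. 1" and a' = 0 and \<phi> = f and h = "H x2 y2"])
       (use x1 x2 assms f in \<open>auto simp: G\<close>)
  show "partial_y (Inr j) G (join_vec x1 x2) (join_vec y1 y2)
           = dsnd f (K x1 y1) (H x2 y2) * partial_y j H x2 y2"
    by (subst partial_y_Inr_product[where a = "\<lambda>_. 1" and a' = 0 and \<phi> = f and k = "K x1 y1"])
       (use x1 x2 assms f in \<open>auto simp: G\<close>)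
  have "partial_x (Inl i) G (join_vec x1 x2) (join_vec y1 y2)
      = partial_deriv i (\<lambda>u. G (join_vec u x2) (join_vec y1 y2)) x1"
    by (simp add: partial_x_def partial_deriv_def join_vec_move)
  also have "\<dots> = partial_deriv i (\<lambda>u. f (K u y1) (H x2 y2)) x1"
    by (rule partial_deriv_cong[OF finsler_energy_open[OF feK]]) (use x1 x2 G in auto)
  also have "\<dots> = dfst f (K x1 y1) (H x2 y2) * partial_x i K x1 y1"
  proof -
    have "((\<lambda>s. f s (H x2 y2)) has_real_derivative dfst f (K x1 y1) (H x2 y2))
        (at (K (x1 + 0 *\<^sub>R axis i 1) y1))"
      using DERIV_dfst[OF f] by simp
    from DERIV_chain2[OF this DERIV_base[OF feK x1 assms(1)]]
    show ?thesis unfolding partial_deriv_def by (rule DERIV_imp_deriv)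
  qed
  finally show "partial_x (Inl i) G (join_vec x1 x2) (join_vec y1 y2)
           = dfst f (K x1 y1) (H x2 y2) * partial_x i K x1 y1" .
  have "partial_x (Inr j) G (join_vec x1 x2) (join_vec y1 y2)
      = partial_deriv j (\<lambda>u. G (join_vec x1 u) (join_vec y1 y2)) x2"
    by (simp add: partial_x_def partial_deriv_def join_vec_move)
  also have "\<dots> = partial_deriv j (\<lambda>u. f (K x1 y1) (H u y2)) x2"
    by (rule partial_deriv_cong[OF finsler_energy_open[OF feH]]) (use x1 x2 G in auto)
  also have "\<dots> = dsnd f (K x1 y1) (H x2 y2) * partial_x j H x2 y2"
  proof -
    have "((\<lambda>s. f (K x1 y1) s) has_real_derivative dsnd f (K x1 y1) (H x2 y2))
        (at (H (x2 + 0 *\<^sub>R axis j 1) y2))"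
      using DERIV_dsnd[OF f] by simp
    from DERIV_chain2[OF this DERIV_base[OF feH x2 assms(2)]]
    show ?thesis unfolding partial_deriv_def by (rule DERIV_imp_deriv)
  qed
  finally show "partial_x (Inr j) G (join_vec x1 x2) (join_vec y1 y2)
           = dsnd f (K x1 y1) (H x2 y2) * partial_x j H x2 y2" .
qed

context
  fixes y1 :: "real^'m" and y2 :: "real^'n"
    and s t :: real
  assumes y1: "y1 \<noteq> 0" and y2: "y2 \<noteq> 0"
    and s: "s = K x1 y1" and t: "t = H x2 y2"
begin

lemma energies_pos: "s > 0" "t > 0"
  unfolding s t by (intro energy_pos[OF feK] energy_pos[OF feH] x1 x2 y1 y2)+

lemma partials_differentiable:
  "(\<lambda>(s, t). dfst f s t) differentiable (at (s, t))"
  "(\<lambda>(s, t). dsnd f s t) differentiable (at (s, t))"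
  by (intro dfst_differentiable dsnd_differentiable pf energies_pos)+

lemma second_partials_product_Inl:
  "partial_y (Inl i) (partial_y (Inl j) G) (join_vec x1 x2) (join_vec y1 y2)
     = dfst (dfst f) s t * partial_y i K x1 y1 * partial_y j K x1 y1
       + dfst f s t * partial_y i (partial_y j K) x1 y1"
  "partial_y (Inl i) (partial_y (Inr j') G) (join_vec x1 x2) (join_vec y1 y2)
     = dfst (dsnd f) s t * partial_y i K x1 y1 * partial_y j' H x2 y2"
  "partial_y (Inl i) (partial_x (Inl j) G) (join_vec x1 x2) (join_vec y1 y2)
     = dfst (dfst f) s t * partial_y i K x1 y1 * partial_x j K x1 y1
       + dfst f s t * partial_y i (partial_x j K) x1 y1"
  "partial_y (Inl i) (partial_x (Inr j') G) (join_vec x1 x2) (join_vec y1 y2)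
     = dfst (dsnd f) s t * partial_y i K x1 y1 * partial_x j' H x2 y2"
  using partial_y_Inl_product[where Q = "partial_y (Inl j) G" and \<phi> = "dfst f" and h = "H x2 y2"
        and a = "partial_y j K x1" and i = i, OF x1 y1 first_partials_product(1)[OF _ y2]
        partials_differentiable(1)[unfolded s t] DERIV_fibre(2)[OF feK x1 y1]]
    partial_y_Inl_product[where Q = "partial_y (Inr j') G" and \<phi> = "dsnd f" and h = "H x2 y2"
        and a = "\<lambda>_. partial_y j' H x2 y2" and i = i, OF x1 y1 first_partials_product(2)[OF _ y2]
        partials_differentiable(2)[unfolded s t] DERIV_const]
    partial_y_Inl_product[where Q = "partial_x (Inl j) G" and \<phi> = "dfst f" and h = "H x2 y2"
        and a = "partial_x j K x1" and i = i, OF x1 y1 first_partials_product(3)[OF _ y2]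
        partials_differentiable(1)[unfolded s t] DERIV_fibre(3)[OF feK x1 y1]]
    partial_y_Inl_product[where Q = "partial_x (Inr j') G" and \<phi> = "dsnd f" and h = "H x2 y2"
        and a = "\<lambda>_. partial_x j' H x2 y2" and i = i, OF x1 y1 first_partials_product(4)[OF _ y2]
        partials_differentiable(2)[unfolded s t] DERIV_const]
  by (simp_all add: s t)

lemma second_partials_product_Inr:
  "partial_y (Inr i') (partial_y (Inl j) G) (join_vec x1 x2) (join_vec y1 y2)
     = dsnd (dfst f) s t * partial_y i' H x2 y2 * partial_y j K x1 y1"
  "partial_y (Inr i') (partial_y (Inr j') G) (join_vec x1 x2) (join_vec y1 y2)
     = dsnd (dsnd f) s t * partial_y i' H x2 y2 * partial_y j' H x2 y2
       + dsnd f s t * partial_y i' (partial_y j' H) x2 y2"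
  "partial_y (Inr i') (partial_x (Inl j) G) (join_vec x1 x2) (join_vec y1 y2)
     = dsnd (dfst f) s t * partial_y i' H x2 y2 * partial_x j K x1 y1"
  "partial_y (Inr i') (partial_x (Inr j') G) (join_vec x1 x2) (join_vec y1 y2)
     = dsnd (dsnd f) s t * partial_y i' H x2 y2 * partial_x j' H x2 y2
       + dsnd f s t * partial_y i' (partial_x j' H) x2 y2"
  using partial_y_Inr_product[where Q = "partial_y (Inl j) G" and \<phi> = "dfst f" and k = "K x1 y1"
        and a = "\<lambda>_. partial_y j K x1 y1" and i = i', OF x2 y2 first_partials_product(1)[OF y1]
        partials_differentiable(1)[unfolded s t] DERIV_const]
    partial_y_Inr_product[where Q = "partial_y (Inr j') G" and \<phi> = "dsnd f" and k = "K x1 y1"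
        and a = "partial_y j' H x2" and i = i', OF x2 y2 first_partials_product(2)[OF y1]
        partials_differentiable(2)[unfolded s t] DERIV_fibre(2)[OF feH x2 y2]]
    partial_y_Inr_product[where Q = "partial_x (Inl j) G" and \<phi> = "dfst f" and k = "K x1 y1"
        and a = "\<lambda>_. partial_x j K x1 y1" and i = i', OF x2 y2 first_partials_product(3)[OF y1]
        partials_differentiable(1)[unfolded s t] DERIV_const]
    partial_y_Inr_product[where Q = "partial_x (Inr j') G" and \<phi> = "dsnd f" and k = "K x1 y1"
        and a = "partial_x j' H x2" and i = i', OF x2 y2 first_partials_product(4)[OF y1]
        partials_differentiable(2)[unfolded s t] DERIV_fibre(3)[OF feH x2 y2]]
  by (simp_all add: s t)

text \<open>In this lemma and the next, each component is a multiple of the corresponding expression of one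
  factor plus a multiple of the fibre gradient of that factor.  The two lemmas have the same
  coefficients, with fibre gradients paired with \<open>u\<close> and \<open>v\<close> in the one and base gradients paired
  with \<open>y1\<close> and \<open>y2\<close> in the other.\<close>

lemma fibre_hessian_product_mult:
  "fibre_hessian G (join_vec x1 x2) (join_vec y1 y2) *v join_vec u v
     = join_vec
         (dfst f s t *\<^sub>R (fibre_hessian K x1 y1 *v u)
           + (dfst (dfst f) s t * (grad_y K x1 y1 \<bullet> u) + dfst (dsnd f) s t * (grad_y H x2 y2 \<bullet> v))
             *\<^sub>R grad_y K x1 y1)
         (dsnd f s t *\<^sub>R (fibre_hessian H x2 y2 *v v)
           + (dsnd (dfst f) s t * (grad_y K x1 y1 \<bullet> u) + dsnd (dsnd f) s t * (grad_y H x2 y2 \<bullet> v))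
             *\<^sub>R grad_y H x2 y2)"
  by (simp add: vec_sum_eq_iff matrix_vector_mult_def fibre_hessian_def grad_y_def inner_vec_def
      sum_UNIV_Plus second_partials_product_Inl second_partials_product_Inr
      sum.distrib sum_distrib_left algebra_simps)

lemma spray_rhs_product:
  "spray_rhs G (join_vec x1 x2) (join_vec y1 y2)
     = join_vec
         (dfst f s t *\<^sub>R spray_rhs K x1 y1
           + (dfst (dfst f) s t * (grad_x K x1 y1 \<bullet> y1) + dfst (dsnd f) s t * (grad_x H x2 y2 \<bullet> y2))
             *\<^sub>R grad_y K x1 y1)
         (dsnd f s t *\<^sub>R spray_rhs H x2 y2
           + (dsnd (dfst f) s t * (grad_x K x1 y1 \<bullet> y1) + dsnd (dsnd f) s t * (grad_x H x2 y2 \<bullet> y2))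
             *\<^sub>R grad_y H x2 y2)"
  by (simp add: vec_sum_eq_iff spray_rhs_def grad_x_def grad_y_def inner_vec_def
      sum_UNIV_Plus second_partials_product_Inl second_partials_product_Inr
      first_partials_product(3,4)[OF y1 y2, folded s t]
      sum.distrib sum_distrib_left algebra_simps)

text \<open>A vector \<open>(u, v)\<close> in the kernel satisfies \<open>f\<^sub>s u = - a y\<^sub>1\<close> and \<open>f\<^sub>t v = - b y\<^sub>2\<close>, where \<open>a\<close> and \<open>b\<close>
  depend on \<open>u\<close> and \<open>v\<close> only through \<open>p = \<langle>\<partial>\<^sub>y K, u\<rangle>\<close> and \<open>q = \<langle>\<partial>\<^sub>y H, v\<rangle>\<close>.  Pairing these equations with
  the gradients leaves two homogeneous linear equations for \<open>p\<close> and \<open>q\<close>, in which Euler's relations for \<open>f\<^sub>s\<close> and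
  \<open>f\<^sub>t\<close> express every second derivative of \<open>f\<close> by the mixed one, \<open>c\<close>.\<close>

lemma fibre_hessian_product_kernel:
  assumes "fibre_hessian G (join_vec x1 x2) (join_vec y1 y2) *v join_vec u v = 0"
  shows "u = 0 \<and> v = 0"
proof -
  define p where "p = grad_y K x1 y1 \<bullet> u"
  define q where "q = grad_y H x2 y2 \<bullet> v"
  define a where "a = dfst (dfst f) s t * p + dfst (dsnd f) s t * q"
  define b where "b = dsnd (dfst f) s t * p + dsnd (dsnd f) s t * q"
  define c where "c = dfst (dsnd f) s t"
  have row1: "dfst f s t *\<^sub>R (fibre_hessian K x1 y1 *v u) + a *\<^sub>R grad_y K x1 y1 = 0"
    and row2: "dsnd f s t *\<^sub>R (fibre_hessian H x2 y2 *v v) + b *\<^sub>R grad_y H x2 y2 = 0"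
    using assms[unfolded fibre_hessian_product_mult]
    by (simp_all add: vec_sum_eq_iff vec_eq_iff a_def b_def p_def q_def)
  have "fibre_hessian K x1 y1 *v (dfst f s t *\<^sub>R u + a *\<^sub>R y1) = 0"
    using row1 fibre_hessian_mult_self[OF feK x1 y1]
    by (simp add: matrix_vector_right_distrib matrix_vector_mult_scaleR)
  then have u: "dfst f s t *\<^sub>R u + a *\<^sub>R y1 = 0" by (rule fibre_hessian_kernel[OF feK x1 y1])
  have "fibre_hessian H x2 y2 *v (dsnd f s t *\<^sub>R v + b *\<^sub>R y2) = 0"
    using row2 fibre_hessian_mult_self[OF feH x2 y2]
    by (simp add: matrix_vector_right_distrib matrix_vector_mult_scaleR)
  then have v: "dsnd f s t *\<^sub>R v + b *\<^sub>R y2 = 0" by (rule fibre_hessian_kernel[OF feH x2 y2])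
  have "grad_y K x1 y1 \<bullet> (dfst f s t *\<^sub>R u + a *\<^sub>R y1) = dfst f s t * p + a * (2 * s)"
    by (simp add: inner_add_right p_def s energy_euler[OF feK x1 y1])
  then have eq1: "dfst f s t * p + 2 * (s * a) = 0" using u by (simp add: mult_ac)
  have "grad_y H x2 y2 \<bullet> (dsnd f s t *\<^sub>R v + b *\<^sub>R y2) = dsnd f s t * q + b * (2 * t)"
    by (simp add: inner_add_right q_def t energy_euler[OF feH x2 y2])
  then have eq2: "dsnd f s t * q + 2 * (t * b) = 0" using v by (simp add: mult_ac)
  have eu: "s * dfst (dfst f) s t = - (t * c)" "t * dsnd (dsnd f) s t = - (s * c)"
    and c': "dsnd (dfst f) s t = c"
    using product_function_euler(2,3)[OF pf energies_pos]
      product_function_mixed_partials[OF pf energies_pos] by (simp_all add: c_def)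
  have "s * a = (s * dfst (dfst f) s t) * p + s * c * q"
    by (simp add: a_def c_def algebra_simps)
  then have sa: "s * a = c * (s * q - t * p)" unfolding eu by (simp add: algebra_simps)
  have "t * b = t * c * p + (t * dsnd (dsnd f) s t) * q"
    by (simp add: b_def c' algebra_simps)
  then have tb: "t * b = c * (t * p - s * q)" unfolding eu by (simp add: algebra_simps)
  \<comment> \<open>The determinant of the system for \<open>p\<close> and \<open>q\<close>.\<close>
  have nd: "dfst f s t * dsnd f s t - 2 * (s * dfst f s t + t * dsnd f s t) * c \<noteq> 0"
    using product_function_nondegenerate(3)[OF pf energies_pos]
    by (simp add: product_function_euler(1)[OF pf energies_pos] c_def)
  \<comment> \<open>Both equations involve \<open>c\<close> only through \<open>s q - t p\<close>; combining them with weights \<open>s f\<^sub>s\<close> and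
    \<open>- t f\<^sub>t\<close> gives the determinant times this quantity.\<close>
  have "s * q - t * p = 0"
  proof -
    have "(dfst f s t * dsnd f s t - 2 * (s * dfst f s t + t * dsnd f s t) * c) * (s * q - t * p)
       = s * dfst f s t * (dsnd f s t * q + 2 * (c * (t * p - s * q)))
         - t * dsnd f s t * (dfst f s t * p + 2 * (c * (s * q - t * p)))"
      by (simp add: algebra_simps)
    also have "\<dots> = 0" using eq1 eq2 by (simp add: sa tb)
    finally show ?thesis using nd by simp
  qed
  then have "s * a = 0" "t * b = 0" using sa tb by simp_all
  then have "a = 0" "b = 0" using energies_pos by simp_all
  then show ?thesis
    using u v product_function_nondegenerate(1,2)[OF pf energies_pos] by simp
qed

end

text \<open>By \<open>fibre_hessian_product_mult\<close> and \<open>spray_rhs_product\<close> the pair of the doubled sprays solves the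
  linear system for the doubled spray of \<open>G\<close>: the coefficients of the gradients agree by \<open>grad_y_spray_dir\<close>.\<close>

lemma spray_coeff_product:
  assumes y1: "y1 \<noteq> 0" and y2: "y2 \<noteq> 0"
  shows "spray_coeff G (Inl i) (join_vec x1 x2) (join_vec y1 y2) = spray_coeff K i x1 y1"
    and "spray_coeff G (Inr j) (join_vec x1 x2) (join_vec y1 y2) = spray_coeff H j x2 y2"
proof -
  let ?A = "fibre_hessian G (join_vec x1 x2) (join_vec y1 y2)"
  let ?g = "spray_dir K x1 y1"
  let ?h = "spray_dir H x2 y2"
  have "?A *v join_vec ?g ?h = spray_rhs G (join_vec x1 x2) (join_vec y1 y2)"
    unfolding fibre_hessian_product_mult[OF y1 y2 refl refl] spray_rhs_product[OF y1 y2 refl refl]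
      fibre_hessian_spray_dir[OF feK x1 y1] fibre_hessian_spray_dir[OF feH x2 y2]
      grad_y_spray_dir[OF feK x1 y1] grad_y_spray_dir[OF feH x2 y2] ..
  moreover have "invertible ?A"
  proof (rule invertible_of_trivial_kernel)
    fix w assume w: "?A *v w = 0"
    obtain u v where uv: "w = join_vec u v" by (rule join_vec_cases)
    with w fibre_hessian_product_kernel[OF y1 y2 refl refl] have "u = 0 \<and> v = 0" by blast
    with uv show "w = 0" by (simp add: vec_sum_eq_iff)
  qed
  ultimately have "spray_dir G (join_vec x1 x2) (join_vec y1 y2) = join_vec ?g ?h"
    unfolding spray_dir_def[of G] by (intro matrix_inv_mult_vector_unique)
  then show "spray_coeff G (Inl i) (join_vec x1 x2) (join_vec y1 y2) = spray_coeff K i x1 y1"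
    and "spray_coeff G (Inr j) (join_vec x1 x2) (join_vec y1 y2) = spray_coeff H j x2 y2"
    by (simp_all add: spray_coeff_eq)
qed

end
end

section \<open>Tangent vectors in product charts\<close>

text \<open>Coordinate vectors vanish on functions that are not differentiable, so equality of pushforwards
  needs differentiability to pass in both directions between \<open>h\<close> and \<open>h \<circ> P\<close>.  The linear section \<open>E\<close>
  of \<open>P\<close> is what brings it back: it restricts \<open>h \<circ> P\<close> to an affine slice through \<open>z\<close>.\<close>

lemma frechet_derivative_through_projection:
  fixes P :: "'z::real_normed_vector \<Rightarrow> 'a::real_normed_vector" and g :: "'z \<Rightarrow> real"
  assumes P: "bounded_linear P" and E: "bounded_linear E" and PE: "\<And>a. P (E a) = a"
    and S: "open S" "z \<in> S" and g: "\<And>w. w \<in> S \<Longrightarrow> g w = h (P w)"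
  shows "g differentiable (at z) \<longleftrightarrow> h differentiable (at (P z))"
    and "h differentiable (at (P z)) \<Longrightarrow>
           frechet_derivative g (at z) w = frechet_derivative h (at (P z)) (P w)"
proof -
  have fwd: "(g has_derivative (\<lambda>w. frechet_derivative h (at (P z)) (P w))) (at z)"
    if h: "h differentiable (at (P z))"
  proof (rule has_derivative_transform_within_open[OF _ S])
    show "((\<lambda>w. h (P w)) has_derivative (\<lambda>w. frechet_derivative h (at (P z)) (P w))) (at z)"
      using has_derivative_compose[OF bounded_linear_imp_has_derivative[OF P]
          frechet_derivative_works[THEN iffD1, OF h]] .
  qed (simp add: g)
  have bwd: "h differentiable (at (P z))" if "g differentiable (at z)"
  proof -
    let ?\<phi> = "\<lambda>a. z + E (a - P z)"
    have \<phi>z: "?\<phi> (P z) = z"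
      using E by (simp add: bounded_linear.linear linear_0)
    have P\<phi>: "P (?\<phi> a) = a" for a
      using linear_add[OF bounded_linear.linear[OF P]] by (simp add: PE)
    have "(?\<phi> has_derivative E) (at (P z))"
      by (auto intro!: derivative_eq_intros bounded_linear.has_derivative[OF E])
    then have "?\<phi> differentiable (at (P z))" unfolding differentiable_def by blast
    then have "(g \<circ> ?\<phi>) differentiable (at (P z))"
      using that by (intro differentiable_chain_at) (simp_all only: \<phi>z)
    moreover have "open (?\<phi> -` S)"
      by (intro open_vimage S linear_continuous_on_compose continuous_intros
          bounded_linear.linear E bounded_linear.continuous_on[OF E])
    ultimately show ?thesis
      by (rule differentiable_cong_open) (use S \<phi>z g P\<phi> in auto)
  qed
  show "g differentiable (at z) \<longleftrightarrow> h differentiable (at (P z))"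
    using fwd bwd unfolding differentiable_def by blast
  show "frechet_derivative g (at z) w = frechet_derivative h (at (P z)) (P w)"
    if "h differentiable (at (P z))"
    using frechet_derivative_at[OF fwd[OF that]] by metis
qed

definition left_part :: "real^('m::finite + 'n::finite) \<Rightarrow> real^'m" where
  "left_part z = (\<chi> i. z $ Inl i)"

definition right_part :: "real^('m::finite + 'n::finite) \<Rightarrow> real^'n" where
  "right_part z = (\<chi> j. z $ Inr j)"

lemma part_join_vec [simp]: "left_part (join_vec u v) = u" "right_part (join_vec u v) = v"
  by (simp_all add: left_part_def right_part_def)

lemma join_vec_parts [simp]: "join_vec (left_part z) (right_part z) = z"
  by (simp add: left_part_def right_part_def vec_sum_eq_iff)

lemma bounded_linear_parts: "bounded_linear left_part" "bounded_linear right_part"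
  by (auto intro!: linearI simp: linear_conv_bounded_linear[symmetric] left_part_def right_part_def
      vec_eq_iff)

lemma bounded_linear_join_vec_0:
  "bounded_linear (\<lambda>u. join_vec u 0)" "bounded_linear (\<lambda>v. join_vec 0 v)"
  by (auto intro!: linearI simp: linear_conv_bounded_linear[symmetric] vec_sum_eq_iff)

lemma chart_inv_in: "x \<in> chart_image c \<Longrightarrow> chart_inv c x \<in> fst c"
  by (simp add: chart_inv_def chart_image_def inv_into_into)

lemma chart_chart_inv: "x \<in> chart_image c \<Longrightarrow> snd c (chart_inv c x) = x"
  by (simp add: chart_inv_def chart_image_def f_inv_into_f)

lemma chart_inv_product:
  assumes "inj_on (snd c) (fst c)" "inj_on (snd d) (fst d)"
    and "x1 \<in> chart_image c" "x2 \<in> chart_image d"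
  shows "chart_inv (product_chart c d) (join_vec x1 x2) = (chart_inv c x1, chart_inv d x2)"
  unfolding chart_inv_def[of "product_chart c d"]
proof (rule inv_into_f_eq)
  show "inj_on (snd (product_chart c d)) (fst (product_chart c d))"
    using assms(1,2) by (auto simp: inj_on_def product_chart_def vec_sum_eq_iff vec_eq_iff)
  show "(chart_inv c x1, chart_inv d x2) \<in> fst (product_chart c d)"
    using assms(3,4) by (simp add: product_chart_def chart_inv_in)
  show "snd (product_chart c d) (chart_inv c x1, chart_inv d x2) = join_vec x1 x2"
    using assms(3,4) by (simp add: product_chart_def chart_chart_inv)
qed

lemma pushforward_coord_vector:
  assumes inj: "inj_on (snd c) (fst c)" "inj_on (snd d) (fst d)"
    and op: "open (chart_image c)" "open (chart_image d)"
    and pq: "p \<in> fst c" "q \<in> fst d"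
  shows "pushforward fst (coord_vector (product_chart c d) (p, q) (join_vec u v)) = coord_vector c p u"
    and "pushforward snd (coord_vector (product_chart c d) (p, q) (join_vec u v)) = coord_vector d q v"
proof -
  let ?S = "left_part -` chart_image c \<inter> right_part -` chart_image d"
  let ?z = "join_vec (snd c p) (snd d q)"
  have S: "open ?S" "?z \<in> ?S"
    using op pq bounded_linear_parts
    by (auto intro!: open_Int open_vimage linear_continuous_on simp: chart_image_def)
  have inv: "chart_inv (product_chart c d) w = (chart_inv c (left_part w), chart_inv d (right_part w))"
    if "w \<in> ?S" for w
    using chart_inv_product[OF inj, of "left_part w" "right_part w"] that by simp
  have z: "snd (product_chart c d) (p, q) = ?z" by (simp add: product_chart_def)
  show "pushforward fst (coord_vector (product_chart c d) (p, q) (join_vec u v)) = coord_vector c p u"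
  proof
    fix g
    note proj = frechet_derivative_through_projection[OF bounded_linear_parts(1)
        bounded_linear_join_vec_0(1) _ S, of "(g \<circ> fst) \<circ> chart_inv (product_chart c d)"
        "g \<circ> chart_inv c"]
    show "pushforward fst (coord_vector (product_chart c d) (p, q) (join_vec u v)) g = coord_vector c p u g"
      using proj by (simp add: pushforward_def coord_vector_def z inv)
  qed
  show "pushforward snd (coord_vector (product_chart c d) (p, q) (join_vec u v)) = coord_vector d q v"
  proof
    fix g
    note proj = frechet_derivative_through_projection[OF bounded_linear_parts(2)
        bounded_linear_join_vec_0(2) _ S, of "(g \<circ> snd) \<circ> chart_inv (product_chart c d)"
        "g \<circ> chart_inv d"]
    show "pushforward snd (coord_vector (product_chart c d) (p, q) (join_vec u v)) g = coord_vector d q v g"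
      using proj by (simp add: pushforward_def coord_vector_def z inv)
  qed
qed

lemma energy_minkowskian_product:
  assumes f: "product_function f"
    and inj: "inj_on (snd c) (fst c)" "inj_on (snd d) (fst d)"
    and op: "open (chart_image c)" "open (chart_image d)"
    and x: "x1 \<in> chart_image c" "x2 \<in> chart_image d"
  shows "energy (minkowskian_product f F1 F2) (product_chart c d) (join_vec x1 x2) (join_vec y1 y2)
           = f (energy F1 c x1 y1) (energy F2 d x2 y2)"
proof -
  have "f (energy F1 c x1 y1) (energy F2 d x2 y2) \<ge> 0"
    using f by (simp add: product_function_def energy_def)
  then show ?thesis
    unfolding energy_def minkowskian_product_def chart_inv_product[OF inj x]
    by (simp add: pushforward_coord_vector[OF inj op chart_inv_in[OF x(1)] chart_inv_in[OF x(2)]])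
qed

lemma coord_vector_scaleR: "coord_vector c p (r *\<^sub>R y) = (\<lambda>g. r * coord_vector c p y g)"
  by (auto simp: coord_vector_def linear_cmul[OF linear_frechet_derivative])

lemma finsler_manifold_chart:
  assumes "finsler_manifold X A F" "c \<in> A"
  shows "inj_on (snd c) (fst c)" and "finsler_energy (chart_image c) (energy F c)"
proof -
  have "openin X (fst c)" and op: "open (chart_image c)"
    and hom: "homeomorphic_map (subtopology X (fst c)) (top_of_set (chart_image c)) (snd c)"
    using assms unfolding finsler_manifold_def smooth_manifold_def by blast+
  then have sub: "fst c \<subseteq> topspace X" using openin_subset by blast
  then have "topspace (subtopology X (fst c)) = fst c" by auto
  then show "inj_on (snd c) (fst c)"
    using hom by (metis homeomorphic_imp_injective_map)
  have "energy F c x (r *\<^sub>R y) = r\<^sup>2 * energy F c x y" if "x \<in> chart_image c" for x r y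
  proof -
    let ?p = "chart_inv c x"
    have p: "?p \<in> fst c" by (rule chart_inv_in[OF that])
    then have "coord_vector c ?p y \<in> tangent_space A ?p"
      using assms(2) unfolding tangent_space_def by blast
    then have "F ?p (\<lambda>g. r * coord_vector c ?p y g) = \<bar>r\<bar> * F ?p (coord_vector c ?p y)"
      using assms(1) p sub unfolding finsler_manifold_def by blast
    then show ?thesis by (simp add: energy_def coord_vector_scaleR power_mult_distrib)
  qed
  then show "finsler_energy (chart_image c) (energy F c)"
    using assms op unfolding finsler_manifold_def finsler_energy_def by blast
qed

section \<open>The Berwald connection of the product\<close>

lemma partial_y_Inl_cong:
  assumes "y1 \<noteq> 0" "\<And>u. u \<noteq> 0 \<Longrightarrow> Q X (join_vec u y2) = q x1 u"
  shows "partial_y (Inl i) Q X (join_vec y1 y2) = partial_y i q x1 y1"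
  unfolding partial_y_Inl_eq unfolding partial_y_def
  by (rule partial_deriv_cong[of "- {0}"]) (use assms in auto)

lemma partial_y_Inr_cong:
  assumes "y2 \<noteq> 0" "\<And>u. u \<noteq> 0 \<Longrightarrow> Q X (join_vec y1 u) = q x2 u"
  shows "partial_y (Inr j) Q X (join_vec y1 y2) = partial_y j q x2 y2"
  unfolding partial_y_Inr_eq unfolding partial_y_def
  by (rule partial_deriv_cong[of "- {0}"]) (use assms in auto)

lemma partial_y_const [simp]: "partial_y i (\<lambda>_ _. c) x y = 0"
  by (simp add: partial_y_def)

text \<open>If a function on the fibre is pulled back from the first factor wherever both components are
  nonzero, then near such points its second fibre derivatives are those of that function, and every
  one with a primed index vanishes.  Near the point both sides have the same difference
  quotients, so the values of \<open>deriv\<close> agree.\<close>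

lemma second_partials_of_pullback_fst:
  fixes Q :: "real^('m::finite + 'n::finite) \<Rightarrow> real^('m + 'n) \<Rightarrow> real"
  assumes Q: "\<And>u v. u \<noteq> 0 \<Longrightarrow> v \<noteq> 0 \<Longrightarrow> Q X (join_vec u v) = q x1 u"
    and y: "y1 \<noteq> 0" "y2 \<noteq> 0"
  shows "partial_y (Inl j) (partial_y (Inl l) Q) X (join_vec y1 y2)
           = partial_y j (partial_y l q) x1 y1"
    and "partial_y (Inr j') (partial_y \<gamma> Q) X (join_vec y1 y2) = 0"
    and "partial_y \<beta> (partial_y (Inr l') Q) X (join_vec y1 y2) = 0"
proof -
  have l: "partial_y (Inl l) Q X (join_vec u v) = partial_y l q x1 u"
    if "u \<noteq> 0" "v \<noteq> 0" for u v l
    by (rule partial_y_Inl_cong) (use that Q in auto)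
  have r: "partial_y (Inr l') Q X (join_vec u v) = 0"
    if "u \<noteq> 0" "v \<noteq> 0" for u v l'
    by (subst partial_y_Inr_cong[where q = "\<lambda>_ _. q x1 u"]) (use that Q in auto)
  show "partial_y (Inl j) (partial_y (Inl l) Q) X (join_vec y1 y2) = partial_y j (partial_y l q) x1 y1"
    by (rule partial_y_Inl_cong) (use y l in auto)
  have r': "partial_y (Inr j') (partial_y (Inl l) Q) X (join_vec y1 y2) = 0" for l
    by (subst partial_y_Inr_cong[where q = "\<lambda>_ _. partial_y l q x1 y1"]) (use y l in auto)
  have rr: "partial_y (Inr j') (partial_y (Inr l') Q) X (join_vec y1 y2) = 0" for j' l'
    by (subst partial_y_Inr_cong[where q = "\<lambda>_ _. 0"]) (use y r in auto)
  have lr: "partial_y (Inl j) (partial_y (Inr l') Q) X (join_vec y1 y2) = 0" for j l'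
    by (subst partial_y_Inl_cong[where q = "\<lambda>_ _. 0"]) (use y r in auto)
  show "partial_y (Inr j') (partial_y \<gamma> Q) X (join_vec y1 y2) = 0"
    by (cases \<gamma>) (use r' rr in auto)
  show "partial_y \<beta> (partial_y (Inr l') Q) X (join_vec y1 y2) = 0"
    by (cases \<beta>) (use lr rr in auto)
qed

lemma second_partials_of_pullback_snd:
  fixes Q :: "real^('m::finite + 'n::finite) \<Rightarrow> real^('m + 'n) \<Rightarrow> real"
  assumes Q: "\<And>u v. u \<noteq> 0 \<Longrightarrow> v \<noteq> 0 \<Longrightarrow> Q X (join_vec u v) = q x2 v"
    and y: "y1 \<noteq> 0" "y2 \<noteq> 0"
  shows "partial_y (Inr j') (partial_y (Inr l') Q) X (join_vec y1 y2)
           = partial_y j' (partial_y l' q) x2 y2"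
    and "partial_y (Inl j) (partial_y \<gamma> Q) X (join_vec y1 y2) = 0"
    and "partial_y \<beta> (partial_y (Inl l) Q) X (join_vec y1 y2) = 0"
proof -
  have r: "partial_y (Inr l') Q X (join_vec u v) = partial_y l' q x2 v"
    if "u \<noteq> 0" "v \<noteq> 0" for u v l'
    by (rule partial_y_Inr_cong) (use that Q in auto)
  have l: "partial_y (Inl l) Q X (join_vec u v) = 0"
    if "u \<noteq> 0" "v \<noteq> 0" for u v l
    by (subst partial_y_Inl_cong[where q = "\<lambda>_ _. q x2 v"]) (use that Q in auto)
  show "partial_y (Inr j') (partial_y (Inr l') Q) X (join_vec y1 y2) = partial_y j' (partial_y l' q) x2 y2"
    by (rule partial_y_Inr_cong) (use y r in auto)
  have lr: "partial_y (Inl j) (partial_y (Inr l') Q) X (join_vec y1 y2) = 0" for l'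
    by (subst partial_y_Inl_cong[where q = "\<lambda>_ _. partial_y l' q x2 y2"]) (use y r in auto)
  have ll: "partial_y (Inl j) (partial_y (Inl l) Q) X (join_vec y1 y2) = 0" for j l
    by (subst partial_y_Inl_cong[where q = "\<lambda>_ _. 0"]) (use y l in auto)
  have rl: "partial_y (Inr j') (partial_y (Inl l) Q) X (join_vec y1 y2) = 0" for j' l
    by (subst partial_y_Inr_cong[where q = "\<lambda>_ _. 0"]) (use y l in auto)
  show "partial_y (Inl j) (partial_y \<gamma> Q) X (join_vec y1 y2) = 0"
    by (cases \<gamma>) (use lr ll in auto)
  show "partial_y \<beta> (partial_y (Inl l) Q) X (join_vec y1 y2) = 0"
    by (cases \<beta>) (use ll rl in auto)
qed

theorem proposition3p4:
  fixes X1 :: "'a topology" and A1 :: "('a, 'm::finite) chart set"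
    and F1 :: "'a \<Rightarrow> 'a tangent_vector \<Rightarrow> real"
    and X2 :: "'b topology" and A2 :: "('b, 'n::finite) chart set"
    and F2 :: "'b \<Rightarrow> 'b tangent_vector \<Rightarrow> real"
    and f :: "real \<Rightarrow> real \<Rightarrow> real"
    and x1 y1 :: "real^'m" and x2 y2 :: "real^'n"
    and i j l :: 'm and i' j' l' :: 'n
  assumes "finsler_manifold X1 A1 F1" and "finsler_manifold X2 A2 F2"
    and "product_function f"
    and "c1 \<in> A1" and "c2 \<in> A2"
    and "x1 \<in> chart_image c1" and "x2 \<in> chart_image c2"
    and "y1 \<noteq> 0" and "y2 \<noteq> 0"
  shows "let \<Gamma> = berwald_coeff (minkowskian_product f F1 F2) (product_chart c1 c2)
                   (join_vec x1 x2) (join_vec y1 y2)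
    in \<Gamma> (Inl i) (Inl j) (Inl l) = berwald_coeff F1 c1 x1 y1 i j l \<and>
       \<Gamma> (Inr i') (Inr j') (Inr l') = berwald_coeff F2 c2 x2 y2 i' j' l' \<and>
       \<Gamma> (Inl i) (Inr j') (Inl l) = 0 \<and>
       \<Gamma> (Inl i) (Inl j) (Inr l') = 0 \<and>
       \<Gamma> (Inl i) (Inr j') (Inr l') = 0 \<and>
       \<Gamma> (Inr i') (Inr j') (Inl l) = 0 \<and>
       \<Gamma> (Inr i') (Inl j) (Inr l') = 0 \<and>
       \<Gamma> (Inr i') (Inl j) (Inl l) = 0"
proof -
  note chart1 = finsler_manifold_chart[OF assms(1,4)]
  note chart2 = finsler_manifold_chart[OF assms(2,5)]
  let ?G = "energy (minkowskian_product f F1 F2) (product_chart c1 c2)"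
  have G: "?G (join_vec z1 z2) (join_vec w1 w2) = f (energy F1 c1 z1 w1) (energy F2 c2 z2 w2)"
    if "z1 \<in> chart_image c1" "z2 \<in> chart_image c2" for z1 z2 w1 w2
    by (rule energy_minkowskian_product[OF assms(3) chart1(1) chart2(1)
          finsler_energy_open[OF chart1(2)] finsler_energy_open[OF chart2(2)] that])
  let ?x = "join_vec x1 x2"
  have spray1: "spray_coeff ?G (Inl i) ?x (join_vec u v) = spray_coeff (energy F1 c1) i x1 u"
    and spray2: "spray_coeff ?G (Inr i') ?x (join_vec u v) = spray_coeff (energy F2 c2) i' x2 v"
    if "u \<noteq> 0" "v \<noteq> 0" for u v i i'
    by (intro spray_coeff_product[OF chart1(2) chart2(2) assms(3) G] assms(6,7) that; assumption)+
  note pull1 = second_partials_of_pullback_fst[where Q = "spray_coeff ?G (Inl i)"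
      and q = "spray_coeff (energy F1 c1) i" for i, OF spray1 assms(8,9)]
  note pull2 = second_partials_of_pullback_snd[where Q = "spray_coeff ?G (Inr i')"
      and q = "spray_coeff (energy F2 c2) i'" for i', OF spray2 assms(8,9)]
  show ?thesis
    by (simp add: berwald_coeff_def nonlinear_coeff_def pull1 pull2)
qed

end
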